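(* Let $m\ge n$, $\mathbf g\sim\mathcal{CN}(\mathbf 0,\sigma_g^2\mathbf I_m)$, $\widetilde{\mathbf b}\in\mathbb C^m$ fixed, and $$\mathcal N(\mathbf g)=\sup_{\mathbf w\in\mathbb{CS}^{n-1}}\Big|\frac1m\mathbf w^\top\mathbf R_{[1:n]}\mathbf C_{\mathbf g}^\top\operatorname{diag}(\widetilde{\mathbf b})\mathbf C_{\mathbf g}\mathbf R_{[1:n]}^\top\mathbf w\Big|.$$ Then whenever $m\ge Cn\log^4n$ for some positive constant $C$, for any integer $p\ge1$, $$\|\mathcal N(\mathbf g)\|_{L^p}\le C_{\sigma_g^2}\|\widetilde{\mathbf b}\|_\infty\Big(\sqrt{\tfrac nm}\log^{3/2}n\log^{1/2}m+\sqrt{\tfrac nm}\sqrt p+\tfrac nm p\Big),$$ where $C_{\sigma_g^2}>0$ depends only on $\sigma_g^2$.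
   Context: $\mathbb{CS}^{n-1}$ is the unit sphere of $\mathbb C^n$; $\mathbf w^\top$ is the (non-conjugate) transpose. $\mathbf g\sim\mathcal{CN}(\mathbf 0,\sigma_g^2\mathbf I_m)$: real and imaginary parts i.i.d. $\mathcal N(\mathbf 0,\tfrac{\sigma_g^2}2\mathbf I_m)$. $\mathbf C_{\mathbf g}$ is the $m\times m$ circulant matrix $(\mathbf C_{\mathbf g})_{jk}=g_{((j-k)\bmod m)+1}$; $\mathbf R_{[1:n]}^\top$ zero-pads $\mathbb C^n$ into $\mathbb C^m$. $\|X\|_{L^p}=(\mathbb E|X|^p)^{1/p}$. *)

theory Defs
  imports "HOL-Probability.Probability"
begin

definition real_gauss :: "real \<Rightarrow> real measure" where
  "real_gauss s = density lborel (normal_density 0 (sqrt s))"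

definition cgauss :: "real \<Rightarrow> complex measure" where
  "cgauss s2 = distr (real_gauss (s2 / 2) \<Otimes>\<^sub>M real_gauss (s2 / 2)) borel
                     (\<lambda>(x, y). Complex x y)"

definition cgauss_vec :: "real \<Rightarrow> nat \<Rightarrow> (nat \<Rightarrow> complex) measure" where
  "cgauss_vec s2 m = PiM {..<m} (\<lambda>_. cgauss s2)"

definition circ :: "nat \<Rightarrow> (nat \<Rightarrow> complex) \<Rightarrow> nat \<Rightarrow> nat \<Rightarrow> complex" where
  "circ m g j k = g (nat ((int j - int k) mod int m))"

text \<open>Bilinear (non-conjugate) form  w^T R C_g^T diag(b) C_g R^T w, written out entrywise.\<close>
definition quad_form :: "nat \<Rightarrow> nat \<Rightarrow> (nat \<Rightarrow> complex) \<Rightarrow> (nat \<Rightarrow> complex)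
                           \<Rightarrow> (nat \<Rightarrow> complex) \<Rightarrow> complex" where
  "quad_form m n b g w =
     (\<Sum>i<n. w i * (\<Sum>j<m. circ m g j i * b j * (\<Sum>k<n. circ m g j k * w k)))"

definition csphere :: "nat \<Rightarrow> (nat \<Rightarrow> complex) set" where
  "csphere n = {w. (\<Sum>i<n. (cmod (w i))\<^sup>2) = 1}"

definition Nsup :: "nat \<Rightarrow> nat \<Rightarrow> (nat \<Rightarrow> complex) \<Rightarrow> (nat \<Rightarrow> complex) \<Rightarrow> real" where
  "Nsup m n b g = (SUP w\<in>csphere n. cmod (quad_form m n b g w / of_nat m))"

definition sup_norm :: "nat \<Rightarrow> (nat \<Rightarrow> complex) \<Rightarrow> real" where
  "sup_norm m b = Max ((\<lambda>j. cmod (b j)) ` {..<m})"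

definition lp_norm :: "'a measure \<Rightarrow> nat \<Rightarrow> ('a \<Rightarrow> real) \<Rightarrow> ennreal" where
  "lp_norm M p X =
     (let I = (\<integral>\<^sup>+ x. ennreal (\<bar>X x\<bar> ^ p) \<partial>M)
      in if I = \<infinity> then \<infinity> else ennreal (enn2real I powr (1 / real p)))"

end

theory Submission
  imports Defs
begin

text \<open>
  Up to the factor 1/m the quadratic form is \<open>w\<^sup>T A w\<close> for the \<open>n \<times> n\<close> matrix
  \<open>A = G\<^sup>T diag(b) G\<close>, where \<open>G\<close> consists of the first \<open>n\<close> columns of the circulant matrix.
  It is controlled by the operator norms of the Hermitian matrices \<open>A + A\<^sup>*\<close> and \<open>\<i>A + (\<i>A)\<^sup>*\<close>,
  and hence by the trace moments \<open>tr H\<^bsup>2Q\<^esup>\<close> with \<open>Q\<close> of order \<open>p + log n\<close>.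

  Gaussian integration by parts in the first factor \<open>A = \<Sum>\<^sub>l g\<^sub>l M\<^sub>l(g)\<close> turns \<open>E tr H\<^bsup>2Q\<^esup>\<close> into
  a sum of terms \<open>E tr (M\<^sub>l H\<^sup>a N\<^sub>l H\<^sup>b)\<close> with \<open>a + b = 2Q - 2\<close>. By Cauchy-Schwarz these are log-convex
  in \<open>a\<close>, so they are at most \<open>\<Theta> tr H\<^bsup>2Q-2\<^esup>\<close>, where \<open>\<Theta>\<close> bounds
  \<open>\<Sum>\<^sub>l M\<^sub>l\<^sup>* M\<^sub>l\<close> and \<open>\<Sum>\<^sub>l M\<^sub>l M\<^sub>l\<^sup>*\<close>. For the chaos
  \<open>\<Theta>\<close> is a sum of norms of Gram matrices \<open>K = G\<^sub>\<beta>\<^sup>* G\<^sub>\<beta>\<close> of circulants with rescaled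
  entries \<open>\<beta>\<^sub>l g\<^sub>l\<close>. The same argument applied to \<open>K\<close> itself closes up, since there \<open>\<Theta>\<close> is
  \<open>n\<close> times the norm of \<open>K\<close>: it yields moments of \<open>K\<close> of order \<open>m + Qn\<close>, and then moments of \<open>H\<close>
  of order \<open>sqrt (Qn (m + Qn)) / m\<close>.
\<close>

section \<open>Log-convexity and traces of words in a Hermitian matrix\<close>

text \<open>Raise log-convexity at \<open>N\<close> to the power \<open>Suc N\<close>, insert the
  induction hypothesis and cancel the common factor \<open>a (Suc N) ^ N\<close>. Interpolation
  between the two ends is thus expressed without roots or logarithms.\<close>

lemma log_convex_last:
  fixes a :: "nat \<Rightarrow> real"
  assumes nn: "\<And>k. 0 \<le> a k"
    and lc: "\<And>k. k < N \<Longrightarrow> (a (Suc k))\<^sup>2 \<le> a k * a (Suc (Suc k))"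
  shows "a N ^ Suc N \<le> a 0 * a (Suc N) ^ N"
  using lc
proof (induction N)
  case 0 then show ?case by simp
next
  case (Suc N)
  have IH: "a N ^ Suc N \<le> a 0 * a (Suc N) ^ N" using Suc by simp
  have "a (Suc N) ^ Suc (Suc N) * a (Suc N) ^ N = ((a (Suc N))\<^sup>2) ^ Suc N"
    by (simp add: power_mult[symmetric] power_add[symmetric] mult_2)
  also have "\<dots> \<le> (a N * a (Suc (Suc N))) ^ Suc N"
    by (rule power_mono) (use Suc.prems in auto)
  also have "\<dots> = a N ^ Suc N * a (Suc (Suc N)) ^ Suc N"
    by (rule power_mult_distrib)
  also have "\<dots> \<le> a 0 * a (Suc N) ^ N * a (Suc (Suc N)) ^ Suc N"
    by (rule mult_right_mono[OF IH]) (simp add: nn)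
  finally have *: "a (Suc N) ^ Suc (Suc N) * a (Suc N) ^ N
      \<le> (a 0 * a (Suc (Suc N)) ^ Suc N) * a (Suc N) ^ N"
    by (simp add: mult_ac)
  show ?case
  proof (cases "a (Suc N) = 0")
    case True then show ?thesis by (simp add: nn)
  next
    case False
    then have "0 < a (Suc N) ^ N" using nn[of "Suc N"] by simp
    then show ?thesis using * mult_le_cancel_right_pos by blast
  qed
qed

text \<open>Log-convexity is symmetric under reversal of the sequence.\<close>

lemma log_convex_first:
  fixes a :: "nat \<Rightarrow> real"
  assumes nn: "\<And>k. 0 \<le> a k"
    and lc: "\<And>k. k < N \<Longrightarrow> (a (Suc k))\<^sup>2 \<le> a k * a (Suc (Suc k))"
  shows "a 1 ^ Suc N \<le> a 0 ^ N * a (Suc N)"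
proof -
  have "(\<lambda>k. a (Suc N - k)) N ^ Suc N \<le> (\<lambda>k. a (Suc N - k)) 0 * (\<lambda>k. a (Suc N - k)) (Suc N) ^ N"
  proof (rule log_convex_last)
    fix k assume k: "k < N"
    have "Suc N - k = Suc (Suc (N - Suc k))" "Suc N - Suc k = Suc (N - Suc k)"
      "Suc N - Suc (Suc k) = N - Suc k" using k by auto
    then show "(a (Suc N - Suc k))\<^sup>2 \<le> a (Suc N - k) * a (Suc N - Suc (Suc k))"
      using lc[of "N - Suc k"] k by (simp add: mult.commute)
  qed (rule nn)
  then show ?thesis by (simp add: mult.commute)
qed

text \<open>The induction removes the right end: \<open>a N\<close> is below a weighted geometric
  mean of \<open>a 0\<close> and \<open>a (Suc N)\<close>, hence below their maximum.\<close>

lemma log_convex_le_max: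
  fixes a :: "nat \<Rightarrow> real"
  assumes nn: "\<And>k. 0 \<le> a k"
    and lc: "\<And>k. Suc k < N \<Longrightarrow> (a (Suc k))\<^sup>2 \<le> a k * a (Suc (Suc k))"
    and "c \<le> N"
  shows "a c \<le> max (a 0) (a N)"
  using lc \<open>c \<le> N\<close>
proof (induction N)
  case 0 then show ?case by simp
next
  case (Suc N)
  let ?M = "max (a 0) (a (Suc N))"
  have M: "0 \<le> ?M" using nn[of 0] by simp
  have "a N ^ Suc N \<le> a 0 * a (Suc N) ^ N"
    by (rule log_convex_last) (use nn Suc.prems in auto)
  also have "\<dots> \<le> ?M * ?M ^ N"
    by (intro mult_mono power_mono) (use nn M in auto)
  finally have "a N ^ Suc N \<le> ?M ^ Suc N" by simp
  then have N: "a N \<le> ?M" using M by (rule power_le_imp_le_base)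
  show ?case
  proof (cases "c \<le> N")
    case True
    then have "a c \<le> max (a 0) (a N)" using Suc by simp
    then show ?thesis using N by auto
  next
    case False
    then have "c = Suc N" using Suc.prems by simp
    then show ?thesis by simp
  qed
qed

text \<open>A form of Young's inequality: whichever of \<open>L * x\<close> and \<open>y\<close> is
  larger controls the product. The weight \<open>L\<close> is later chosen so that the last term can
  be absorbed.\<close>

lemma mult_power_le_split:
  fixes x y L :: real
  assumes "0 \<le> x" "0 \<le> y" "0 < L"
  shows "x * y ^ k \<le> L ^ k * x ^ Suc k + y ^ Suc k / L"
proof (cases "y \<le> L * x")
  case True
  have "x * y ^ k \<le> x * (L * x) ^ k"
    by (intro mult_left_mono power_mono True assms)
  also have "\<dots> = L ^ k * x ^ Suc k" by (simp add: power_mult_distrib mult_ac)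
  finally show ?thesis using assms by (simp add: add_increasing2)
next
  case False
  then have "x \<le> y / L" using assms by (simp add: field_simps)
  then have "x * y ^ k \<le> y / L * y ^ k" using assms by (intro mult_right_mono) auto
  moreover have "0 \<le> L ^ k * x ^ Suc k" using assms by simp
  ultimately show ?thesis by simp
qed

lemma Cauchy_Schwarz_complex_sum:
  fixes a b :: "'i \<Rightarrow> complex"
  shows "(cmod (\<Sum>i\<in>I. a i * b i))\<^sup>2 \<le> (\<Sum>i\<in>I. (cmod (a i))\<^sup>2) * (\<Sum>i\<in>I. (cmod (b i))\<^sup>2)"
proof -
  have "cmod (\<Sum>i\<in>I. a i * b i) \<le> (\<Sum>i\<in>I. cmod (a i) * cmod (b i))"
    by (rule sum_norm_le) (simp add: norm_mult)
  then have "(cmod (\<Sum>i\<in>I. a i * b i))\<^sup>2 \<le> (\<Sum>i\<in>I. cmod (a i) * cmod (b i))\<^sup>2"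
    by (intro power_mono) auto
  also have "\<dots> \<le> (\<Sum>i\<in>I. (cmod (a i))\<^sup>2) * (\<Sum>i\<in>I. (cmod (b i))\<^sup>2)"
    by (rule Cauchy_Schwarz_ineq_sum)
  finally show ?thesis .
qed

section \<open>Matrix calculus: products, powers, adjoints, traces and the Frobenius norm\<close>

type_synonym cmat = "nat \<Rightarrow> nat \<Rightarrow> complex"

text \<open>Matrices are cut off to the block of indices below \<open>n\<close>, so that associativity and the power laws
  hold as equations between functions.\<close>

definition mat_mult :: "nat \<Rightarrow> cmat \<Rightarrow> cmat \<Rightarrow> cmat" where
  "mat_mult n A B = (\<lambda>i k. if i < n \<and> k < n then \<Sum>j<n. A i j * B j k else 0)"

definition mat_one :: "nat \<Rightarrow> cmat" where
  "mat_one n = (\<lambda>i k. if i = k \<and> i < n then 1 else 0)"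

primrec mat_pow :: "nat \<Rightarrow> cmat \<Rightarrow> nat \<Rightarrow> cmat" where
  "mat_pow n X 0 = mat_one n"
| "mat_pow n X (Suc k) = mat_mult n X (mat_pow n X k)"

definition adj :: "cmat \<Rightarrow> cmat" where
  "adj A = (\<lambda>i k. cnj (A k i))"

definition tr :: "nat \<Rightarrow> cmat \<Rightarrow> complex" where
  "tr n A = (\<Sum>i<n. A i i)"

definition frob2 :: "nat \<Rightarrow> cmat \<Rightarrow> real" where
  "frob2 n A = (\<Sum>i<n. \<Sum>k<n. (cmod (A i k))\<^sup>2)"

definition mat_vec :: "nat \<Rightarrow> cmat \<Rightarrow> (nat \<Rightarrow> complex) \<Rightarrow> nat \<Rightarrow> complex" where
  "mat_vec n A x = (\<lambda>i. \<Sum>k<n. A i k * x k)"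

definition vnorm2 :: "nat \<Rightarrow> (nat \<Rightarrow> complex) \<Rightarrow> real" where
  "vnorm2 n x = (\<Sum>i<n. (cmod (x i))\<^sup>2)"

lemma vnorm2_nonneg [simp]: "0 \<le> vnorm2 n x" by (simp add: vnorm2_def sum_nonneg)
lemma frob2_nonneg [simp]: "0 \<le> frob2 n A" by (simp add: frob2_def sum_nonneg)

lemma mat_mult_assoc: "mat_mult n (mat_mult n A B) C = mat_mult n A (mat_mult n B C)"
proof -
  have "(\<Sum>j<n. (\<Sum>l<n. A i l * B l j) * C j k) = (\<Sum>j<n. A i j * (\<Sum>l<n. B j l * C l k))" for i k
    by (simp add: sum_distrib_left sum_distrib_right mult.assoc) (rule sum.swap)
  then show ?thesis by (intro ext) (simp add: mat_mult_def)
qed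

lemma mat_one_left: "mat_mult n (mat_one n) (mat_mult n A B) = mat_mult n A B"
  by (intro ext) (simp add: mat_mult_def mat_one_def if_distrib[of "\<lambda>x. x * _"] if_distribR
      sum.delta cong: if_cong)

lemma mat_one_mult_pow: "mat_mult n (mat_one n) (mat_pow n X k) = mat_pow n X k"
  by (cases k) (auto simp: mat_one_left, (intro ext, simp add: mat_mult_def mat_one_def
      if_distrib[of "\<lambda>x. x * _"] sum.delta cong: if_cong))

lemma mat_pow_add: "mat_pow n X (a + b) = mat_mult n (mat_pow n X a) (mat_pow n X b)"
  by (induction a) (simp_all add: mat_one_mult_pow mat_mult_assoc)

lemma mat_pow_Suc_right: "mat_mult n (mat_pow n X k) X = mat_pow n X (Suc k)"
proof (induction k)
  case 0
  show ?case
    by (intro ext) (simp add: mat_mult_def mat_one_def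
      if_distrib[of "\<lambda>x. x * _"] if_distrib[of "\<lambda>x. _ * x"] sum.delta sum.delta' cong: if_cong)
next
  case (Suc k)
  then show ?case by (simp add: mat_mult_assoc)
qed

lemma adj_mult: "adj (mat_mult n A B) = mat_mult n (adj B) (adj A)"
  by (intro ext) (simp add: adj_def mat_mult_def mult.commute)

lemma adj_adj [simp]: "adj (adj A) = A"
  by (simp add: adj_def)

lemma adj_pow:
  assumes "adj X = X" shows "adj (mat_pow n X k) = mat_pow n X k"
proof (induction k)
  case 0 then show ?case by (auto simp: adj_def mat_one_def fun_eq_iff)
next
  case (Suc k)
  then show ?case using mat_pow_Suc_right[of n X k] by (simp add: adj_mult assms)
qed

lemma tr_mult: "tr n (mat_mult n A B) = (\<Sum>i<n. \<Sum>j<n. A i j * B j i)"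
  by (simp add: tr_def mat_mult_def)

lemma tr_mult_commute: "tr n (mat_mult n A B) = tr n (mat_mult n B A)"
  unfolding tr_mult by (subst sum.swap) (simp add: mult.commute)

lemma tr_adj: "tr n (adj A) = cnj (tr n A)"
  by (simp add: tr_def adj_def)

lemma frob2_adj: "frob2 n (adj A) = frob2 n A"
  unfolding frob2_def adj_def by (subst sum.swap) simp

lemma tr_adj_mult_self: "tr n (mat_mult n (adj A) A) = of_real (frob2 n A)"
  unfolding tr_mult frob2_def adj_def
  by (subst sum.swap) (simp add: complex_norm_square mult.commute del: of_real_power)

text \<open>Cauchy-Schwarz over the triples \<open>(l, i, j)\<close>. No adjoint appears on the left
  because \<open>frob2\<close> is invariant under \<open>adj\<close>.\<close>

lemma tr_Cauchy_Schwarz: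
  assumes "finite L"
  shows "(cmod (\<Sum>l\<in>L. tr n (mat_mult n (A l) (B l))))\<^sup>2
    \<le> (\<Sum>l\<in>L. frob2 n (A l)) * (\<Sum>l\<in>L. frob2 n (B l))"
proof -
  let ?I = "L \<times> ({..<n} \<times> {..<n})"
  have 1: "(\<Sum>l\<in>L. tr n (mat_mult n (A l) (B l))) = (\<Sum>(l,i,j)\<in>?I. A l i j * B l j i)"
    by (simp add: tr_mult sum.cartesian_product)
  have 2: "(\<Sum>l\<in>L. frob2 n (A l)) = (\<Sum>(l,i,j)\<in>?I. (cmod (A l i j))\<^sup>2)"
    by (simp add: frob2_def sum.cartesian_product)
  have "(\<Sum>l\<in>L. frob2 n (B l)) = (\<Sum>l\<in>L. frob2 n (adj (B l)))"
    by (simp add: frob2_adj)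
  also have "\<dots> = (\<Sum>(l,i,j)\<in>?I. (cmod (B l j i))\<^sup>2)"
    by (simp add: frob2_def adj_def sum.cartesian_product)
  finally have 3: "(\<Sum>l\<in>L. frob2 n (B l)) = (\<Sum>(l,i,j)\<in>?I. (cmod (B l j i))\<^sup>2)" .
  show ?thesis unfolding 1 2 3
    using Cauchy_Schwarz_complex_sum[of "\<lambda>(l,i,j). A l i j" "\<lambda>(l,i,j). B l j i" ?I]
    by (simp add: case_prod_unfold)
qed

lemma frob2_mult_cols: "frob2 n (mat_mult n A B) = (\<Sum>k<n. vnorm2 n (mat_vec n A (\<lambda>j. B j k)))"
  unfolding frob2_def vnorm2_def by (subst sum.swap) (simp add: mat_mult_def mat_vec_def)

lemma frob2_cols: "frob2 n B = (\<Sum>k<n. vnorm2 n (\<lambda>j. B j k))"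
  unfolding frob2_def vnorm2_def by (rule sum.swap)

section \<open>Families of matrices and traces of words\<close>

text \<open>In operator terms, the sum of M(l)* M(l) is at most \<open>\<Theta>\<close> times the
  identity.\<close>

definition family_bound :: "nat \<Rightarrow> 'l set \<Rightarrow> real \<Rightarrow> ('l \<Rightarrow> cmat) \<Rightarrow> bool" where
  "family_bound n L \<Theta> M \<longleftrightarrow> (\<forall>x. (\<Sum>l\<in>L. vnorm2 n (mat_vec n (M l) x)) \<le> \<Theta> * vnorm2 n x)"

lemma family_bound_frob2:
  assumes "family_bound n L \<Theta> M"
  shows "(\<Sum>l\<in>L. frob2 n (mat_mult n (M l) B)) \<le> \<Theta> * frob2 n B"
proof -
  have "(\<Sum>l\<in>L. frob2 n (mat_mult n (M l) B))
      = (\<Sum>k<n. \<Sum>l\<in>L. vnorm2 n (mat_vec n (M l) (\<lambda>j. B j k)))"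
    unfolding frob2_mult_cols by (rule sum.swap)
  also have "\<dots> \<le> (\<Sum>k<n. \<Theta> * vnorm2 n (\<lambda>j. B j k))"
    by (intro sum_mono) (use assms in \<open>simp add: family_bound_def\<close>)
  also have "\<dots> = \<Theta> * frob2 n B" by (simp add: frob2_cols[of n B] sum_distrib_left)
  finally show ?thesis .
qed

text \<open>By cyclicity only \<open>a + a'\<close> and \<open>b + b'\<close> enter, so powers can
  be moved between the two factors. This is the source of log-convexity.\<close>

lemma frob2_sandwich_inner:
  assumes "adj X = X"
  shows "tr n (mat_mult n (adj (mat_mult n (mat_pow n X a) (mat_mult n M (mat_pow n X b))))
             (mat_mult n (mat_pow n X a') (mat_mult n M (mat_pow n X b'))))
       = tr n (mat_mult n (adj M) (mat_mult n (mat_pow n X (a + a'))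
            (mat_mult n M (mat_pow n X (b' + b)))))"
proof -
  have "tr n (mat_mult n (adj (mat_mult n (mat_pow n X a) (mat_mult n M (mat_pow n X b))))
             (mat_mult n (mat_pow n X a') (mat_mult n M (mat_pow n X b'))))
     = tr n (mat_mult n (mat_pow n X b) (mat_mult n (adj M) (mat_mult n (mat_pow n X a)
             (mat_mult n (mat_pow n X a') (mat_mult n M (mat_pow n X b'))))))"
    by (simp add: adj_mult adj_pow[OF assms] mat_mult_assoc)
  also have "\<dots> = tr n (mat_mult n (adj M) (mat_mult n (mat_pow n X (a + a'))
            (mat_mult n M (mat_pow n X (b' + b)))))"
    by (subst tr_mult_commute) (simp add: mat_pow_add mat_mult_assoc)
  finally show ?thesis .
qed

text \<open>The sum is log-convex in \<open>c\<close>, so it is largest at \<open>c = 0\<close> or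
  \<open>c = r\<close>. There one power is trivial, and the bound for \<open>M\<close> or for its
  adjoints applies.\<close>

lemma sandwich_frob2_le:
  assumes X: "adj X = X" and L: "finite L"
    and M: "family_bound n L \<Theta> M" "family_bound n L \<Theta> (\<lambda>l. adj (M l))"
    and "c \<le> r"
  shows "(\<Sum>l\<in>L. frob2 n (mat_mult n (mat_pow n X c) (mat_mult n (M l) (mat_pow n X (r - c)))))
    \<le> \<Theta> * frob2 n (mat_pow n X r)"
proof -
  define V where "V c l = mat_mult n (mat_pow n X c) (mat_mult n (M l) (mat_pow n X (r - c)))" for c l
  define a where "a c = (\<Sum>l\<in>L. frob2 n (V c l))" for c
  have inner: "complex_of_real (a (Suc k)) = (\<Sum>l\<in>L. tr n (mat_mult n (adj (V k l)) (V (Suc (Suc k)) l)))"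
    if k: "Suc k < r" for k
  proof -
    \<comment> \<open>Moving one power across turns the value at \<open>Suc k\<close> into the
      pairing of its two neighbours.\<close>
    have e: "k + Suc (Suc k) = Suc k + Suc k" "r - Suc (Suc k) + (r - k) = r - Suc k + (r - Suc k)"
      using k by auto
    have "tr n (mat_mult n (adj (V k l)) (V (Suc (Suc k)) l))
        = tr n (mat_mult n (adj (V (Suc k) l)) (V (Suc k) l))" for l
      unfolding V_def frob2_sandwich_inner[OF X] e ..
    then show ?thesis by (simp add: a_def tr_adj_mult_self)
  qed
  have "a c \<le> max (a 0) (a r)"
  proof (rule log_convex_le_max)
    show "0 \<le> a k" for k by (simp add: a_def sum_nonneg)
    fix k assume k: "Suc k < r"
    have "(a (Suc k))\<^sup>2 = (cmod (\<Sum>l\<in>L. tr n (mat_mult n (adj (V k l)) (V (Suc (Suc k)) l))))\<^sup>2"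
      unfolding inner[OF k, symmetric] by simp
    also have "\<dots> \<le> a k * a (Suc (Suc k))"
      unfolding a_def using tr_Cauchy_Schwarz[OF L, of n "\<lambda>l. adj (V k l)" "V (Suc (Suc k))"]
      by (simp add: frob2_adj)
    finally show "(a (Suc k))\<^sup>2 \<le> a k * a (Suc (Suc k))" .
  qed fact
  moreover have "a 0 \<le> \<Theta> * frob2 n (mat_pow n X r)"
    using family_bound_frob2[OF M(1), of "mat_pow n X r"]
    by (simp add: a_def V_def mat_one_left)
  moreover have "a r \<le> \<Theta> * frob2 n (mat_pow n X r)"
  proof -
    have "adj (V r l) = mat_mult n (adj (M l)) (mat_pow n X r)" for l
      by (simp add: V_def adj_mult adj_pow[OF X] mat_mult_assoc mat_one_left
          adj_pow[OF X, where k = 0, simplified])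
    then have "frob2 n (V r l) = frob2 n (mat_mult n (adj (M l)) (mat_pow n X r))" for l
      using frob2_adj[of n "V r l"] by simp
    then show ?thesis using family_bound_frob2[OF M(2), of "mat_pow n X r"]
      by (simp add: a_def)
  qed
  ultimately show ?thesis unfolding a_def V_def by linarith
qed

text \<open>Cutting the cyclic word inside both blocks of powers makes it a pairing of two
  sandwiches of total exponent \<open>r\<close>; Cauchy-Schwarz then treats \<open>M\<close> and
  \<open>N\<close> separately.\<close>

lemma family_bound_tr_le:
  assumes X: "adj X = X" and L: "finite L" and \<Theta>: "0 \<le> \<Theta>"
    and M: "family_bound n L \<Theta> M" "family_bound n L \<Theta> (\<lambda>l. adj (M l))"
    and N: "family_bound n L \<Theta> N" "family_bound n L \<Theta> (\<lambda>l. adj (N l))"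
    and ab: "a + b = 2 * r"
  shows "cmod (\<Sum>l\<in>L. tr n (mat_mult n (M l) (mat_mult n (mat_pow n X a)
            (mat_mult n (N l) (mat_pow n X b))))) \<le> \<Theta> * frob2 n (mat_pow n X r)"
proof -
  \<comment> \<open>Halving \<open>a\<close> keeps both pieces at most \<open>r\<close>, also for
    odd \<open>a\<close>.\<close>
  define a1 a2 where "a1 = a div 2" and "a2 = a - a div 2"
  have a: "a = a2 + a1" "a1 \<le> r" "a2 \<le> r" "b = (r - a1) + (r - a2)"
    using ab by (auto simp: a1_def a2_def)
  let ?P = "\<lambda>l. mat_mult n (mat_pow n X (r - a2)) (mat_mult n (M l) (mat_pow n X (r - (r - a2))))"
  let ?R = "\<lambda>l. mat_mult n (mat_pow n X a1) (mat_mult n (N l) (mat_pow n X (r - a1)))"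
  have "tr n (mat_mult n (M l) (mat_mult n (mat_pow n X a) (mat_mult n (N l) (mat_pow n X b))))
      = tr n (mat_mult n (?P l) (?R l))" for l
  proof -
    have "tr n (mat_mult n (?P l) (?R l))
       = tr n (mat_mult n (mat_pow n X (r - a2)) (mat_mult n (M l) (mat_mult n (mat_pow n X a2) (?R l))))"
      using a by (simp add: mat_mult_assoc)
    also have "\<dots> = tr n (mat_mult n (M l) (mat_mult n (mat_pow n X a) (mat_mult n (N l) (mat_pow n X b))))"
      by (subst tr_mult_commute) (simp add: mat_mult_assoc a(1,4) mat_pow_add)
    finally show ?thesis by simp
  qed
  then have "(cmod (\<Sum>l\<in>L. tr n (mat_mult n (M l) (mat_mult n (mat_pow n X a)
            (mat_mult n (N l) (mat_pow n X b))))))\<^sup>2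
      \<le> (\<Sum>l\<in>L. frob2 n (?P l)) * (\<Sum>l\<in>L. frob2 n (?R l))"
    using tr_Cauchy_Schwarz[OF L, of n ?P ?R] by simp
  also have "\<dots> \<le> (\<Theta> * frob2 n (mat_pow n X r)) * (\<Theta> * frob2 n (mat_pow n X r))"
    by (intro mult_mono sandwich_frob2_le[OF X L M] sandwich_frob2_le[OF X L N])
      (use a \<Theta> in \<open>auto intro!: sum_nonneg\<close>)
  finally show ?thesis
    unfolding power2_eq_square[of "\<Theta> * _", symmetric]
    by (rule power2_le_imp_le) (use \<Theta> in simp)
qed

section \<open>Schatten norms\<close>

lemma vnorm2_cong: "(\<And>i. i < n \<Longrightarrow> x i = y i) \<Longrightarrow> vnorm2 n x = vnorm2 n y"
  by (simp add: vnorm2_def)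

lemma mat_vec_one: "i < n \<Longrightarrow> mat_vec n (mat_one n) x i = x i"
  by (simp add: mat_vec_def mat_one_def if_distrib[of "\<lambda>x. x * _"] sum.delta' cong: if_cong)

lemma mat_vec_mult: "i < n \<Longrightarrow> mat_vec n (mat_mult n A B) x i = mat_vec n A (mat_vec n B x) i"
  by (simp add: mat_vec_def mat_mult_def sum_distrib_left sum_distrib_right mult.assoc)
    (rule sum.swap)

lemma vnorm2_mat_vec_le: "vnorm2 n (mat_vec n A x) \<le> frob2 n A * vnorm2 n x"
proof -
  have "vnorm2 n (mat_vec n A x) \<le> (\<Sum>i<n. (\<Sum>k<n. (cmod (A i k))\<^sup>2) * vnorm2 n x)"
    unfolding vnorm2_def mat_vec_def by (intro sum_mono Cauchy_Schwarz_complex_sum)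
  then show ?thesis by (simp add: frob2_def sum_distrib_right)
qed

text \<open>A vector placed in column 0 of a zero matrix makes the trace Cauchy-Schwarz inequality
  available for vectors; \<open>0 < n\<close> provides the column.\<close>

lemma vnorm2_eq_frob2:
  assumes "0 < n"
  shows "vnorm2 n (mat_vec n A x) = frob2 n (mat_mult n A (\<lambda>i k. if k = 0 then x i else 0))"
proof -
  have "frob2 n (mat_mult n A (\<lambda>i k. if k = 0 then x i else 0))
      = (\<Sum>k<n. if k = 0 then vnorm2 n (mat_vec n A x) else 0)"
    unfolding frob2_mult_cols
    by (rule sum.cong) (auto simp: vnorm2_def mat_vec_def)
  then show ?thesis using assms by (simp add: sum.delta)
qed

text \<open>The squared norm of X^(j+1) x is the inner product of X^j x and X^(j+2) x.\<close>

lemma vnorm2_pow_log_convex: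
  assumes X: "adj X = X" and n: "0 < n"
  shows "(vnorm2 n (mat_vec n (mat_pow n X (Suc j)) x))\<^sup>2
     \<le> vnorm2 n (mat_vec n (mat_pow n X j) x) * vnorm2 n (mat_vec n (mat_pow n X (Suc (Suc j))) x)"
proof -
  let ?x = "\<lambda>i k::nat. if k = 0 then x i else 0"
  define V where "V j = mat_mult n (mat_pow n X j) ?x" for j
  have V: "tr n (mat_mult n (adj (V a)) (V b)) = tr n (mat_mult n (adj ?x) (mat_mult n (mat_pow n X (a + b)) ?x))" for a b
    by (simp add: V_def adj_mult adj_pow[OF X] mat_mult_assoc mat_pow_add)
  have "complex_of_real (frob2 n (V (Suc j))) = tr n (mat_mult n (adj (V j)) (V (Suc (Suc j))))"
    unfolding tr_adj_mult_self[symmetric] V by simp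
  then have "frob2 n (V (Suc j)) = cmod (tr n (mat_mult n (adj (V j)) (V (Suc (Suc j)))))"
    by (metis abs_of_nonneg frob2_nonneg norm_of_real)
  then have "(frob2 n (V (Suc j)))\<^sup>2 \<le> frob2 n (V j) * frob2 n (V (Suc (Suc j)))"
    using tr_Cauchy_Schwarz[of "{()}" n "\<lambda>_. adj (V j)" "\<lambda>_. V (Suc (Suc j))"]
    by (simp add: frob2_adj)
  then show ?thesis by (simp only: V_def vnorm2_eq_frob2[OF n])
qed

lemma frob2_pow_log_convex:
  assumes X: "adj X = X"
  shows "(frob2 n (mat_pow n X (Suc j)))\<^sup>2
     \<le> frob2 n (mat_pow n X j) * frob2 n (mat_pow n X (Suc (Suc j)))"
proof -
  have V: "tr n (mat_mult n (adj (mat_pow n X a)) (mat_pow n X b)) = tr n (mat_pow n X (a + b))" for a b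
    by (simp add: adj_pow[OF X] mat_pow_add)
  have "complex_of_real (frob2 n (mat_pow n X (Suc j)))
      = tr n (mat_mult n (adj (mat_pow n X j)) (mat_pow n X (Suc (Suc j))))"
    unfolding tr_adj_mult_self[symmetric] V by simp
  then have "frob2 n (mat_pow n X (Suc j))
      = cmod (tr n (mat_mult n (adj (mat_pow n X j)) (mat_pow n X (Suc (Suc j)))))"
    by (metis abs_of_nonneg frob2_nonneg norm_of_real)
  then show ?thesis
    using tr_Cauchy_Schwarz[of "{()}" n "\<lambda>_. adj (mat_pow n X j)" "\<lambda>_. mat_pow n X (Suc (Suc j))"]
    by (simp add: frob2_adj del: mat_pow.simps)
qed

lemma tr_pow_even:
  assumes "adj X = X" shows "tr n (mat_pow n X (2 * Q)) = of_real (frob2 n (mat_pow n X Q))"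
  using tr_adj_mult_self[of n "mat_pow n X Q"]
  by (simp add: adj_pow[OF assms] mat_pow_add mult_2)

lemma frob2_one: "frob2 n (mat_one n) = real n"
proof -
  have "frob2 n (mat_one n) = (\<Sum>i<n. \<Sum>k<n. if i = k then 1 else 0)"
    unfolding frob2_def mat_one_def by (intro sum.cong refl) auto
  then show ?thesis by simp
qed

text \<open>For Hermitian \<open>X\<close> the radicand is the trace of X^(2Q), so this is the
  Schatten norm of order 2Q. The trace is polynomial in the entries, which suits expectations better
  than eigenvalues.\<close>

definition schatten :: "nat \<Rightarrow> nat \<Rightarrow> cmat \<Rightarrow> real" where
  "schatten n Q X = root (2 * Q) (frob2 n (mat_pow n X Q))"

lemma schatten_nonneg [simp]: "0 \<le> schatten n Q X"
  by (simp add: schatten_def real_root_ge_zero)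

lemma schatten_power: "0 < Q \<Longrightarrow> schatten n Q X ^ (2 * Q) = frob2 n (mat_pow n X Q)"
  by (simp add: schatten_def)

text \<open>Log-convexity of |X^j x|^2 in j reduces the first power to the \<open>Q\<close>-th,
  where the crude Frobenius bound suffices after taking roots.\<close>

lemma vnorm2_mat_vec_le_schatten:
  assumes X: "adj X = X" and Q: "0 < Q"
  shows "vnorm2 n (mat_vec n X x) \<le> (schatten n Q X)\<^sup>2 * vnorm2 n x"
proof (cases "n = 0")
  case True then show ?thesis by (simp add: vnorm2_def)
next
  case False
  then have n: "0 < n" by simp
  define f where "f j = vnorm2 n (mat_vec n (mat_pow n X j) x)" for j
  obtain N where N: "Q = Suc N" using Q gr0_implies_Suc by blast
  have f0: "f 0 = vnorm2 n x"
    unfolding f_def by (rule vnorm2_cong) (simp add: mat_vec_one)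
  have f1: "f 1 = vnorm2 n (mat_vec n X x)"
  proof -
    have "mat_vec n X (mat_vec n (mat_one n) x) = mat_vec n X x"
      unfolding mat_vec_def[of n X] by (simp add: mat_vec_one)
    then show ?thesis unfolding f_def
      by (intro vnorm2_cong) (simp add: mat_vec_mult)
  qed
  have "f 1 ^ Q \<le> f 0 ^ N * f Q" unfolding N
    by (rule log_convex_first)
      (simp_all only: f_def vnorm2_nonneg vnorm2_pow_log_convex[OF X n])
  also have "\<dots> \<le> f 0 ^ N * (frob2 n (mat_pow n X Q) * vnorm2 n x)"
    unfolding f_def by (intro mult_left_mono vnorm2_mat_vec_le) simp
  also have "\<dots> = ((schatten n Q X)\<^sup>2 * vnorm2 n x) ^ Q"
  proof -
    have "v ^ N * (z ^ Q * v) = (z * v) ^ Q" for v z :: real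
      by (simp add: N power_mult_distrib)
    then show ?thesis unfolding f0 schatten_power[OF Q, symmetric] power_mult .
  qed
  finally show ?thesis unfolding f1 N by (rule power_le_imp_le_base) simp
qed

lemma form_le_schatten:
  assumes X: "adj X = X" and Q: "0 < Q"
  shows "cmod (\<Sum>i<n. y i * mat_vec n X x i) \<le> schatten n Q X * sqrt (vnorm2 n y * vnorm2 n x)"
proof (rule power2_le_imp_le)
  have "(cmod (\<Sum>i<n. y i * mat_vec n X x i))\<^sup>2 \<le> vnorm2 n y * vnorm2 n (mat_vec n X x)"
    unfolding vnorm2_def by (rule Cauchy_Schwarz_complex_sum)
  also have "\<dots> \<le> vnorm2 n y * ((schatten n Q X)\<^sup>2 * vnorm2 n x)"
    by (intro mult_left_mono vnorm2_mat_vec_le_schatten[OF X Q]) simp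
  finally show "(cmod (\<Sum>i<n. y i * mat_vec n X x i))\<^sup>2
      \<le> (schatten n Q X * sqrt (vnorm2 n y * vnorm2 n x))\<^sup>2"
    by (simp add: power_mult_distrib mult_ac)
qed simp

text \<open>Log-convexity starting from \<open>frob2 n (mat_one n)\<close>, which is n, lowers the
  exponent at the cost n^(1/(N+1)); the hypothesis makes this cost at most 3.\<close>

lemma frob2_pow_pred_le:
  assumes X: "adj X = X" and n: "real n \<le> 3 ^ Suc N"
  shows "frob2 n (mat_pow n X N) \<le> 3 * schatten n (Suc N) X ^ (2 * N)"
proof (rule power_le_imp_le_base)
  let ?y = "schatten n (Suc N) X"
  have "frob2 n (mat_pow n X N) ^ Suc N
      \<le> frob2 n (mat_pow n X 0) * frob2 n (mat_pow n X (Suc N)) ^ N"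
    by (rule log_convex_last) (simp_all only: frob2_nonneg frob2_pow_log_convex[OF X])
  also have "\<dots> \<le> 3 ^ Suc N * (?y ^ (2 * Suc N)) ^ N"
    unfolding schatten_power[OF zero_less_Suc] using n
    by (intro mult_right_mono) (simp_all add: frob2_one)
  also have "\<dots> = (3 * ?y ^ (2 * N)) ^ Suc N"
    by (simp only: power_mult_distrib power_mult[symmetric]) (simp only: mult_ac)
  finally show "frob2 n (mat_pow n X N) ^ Suc N \<le> (3 * ?y ^ (2 * N)) ^ Suc N" .
qed simp

text \<open>Split as X^N X^(N+1); Cauchy-Schwarz leaves the two neighbouring even traces.\<close>

lemma tr_pow_odd_le:
  assumes X: "adj X = X" and n: "real n \<le> 3 ^ Suc N"
  shows "cmod (tr n (mat_pow n X (2 * N + 1))) \<le> 3 * schatten n (Suc N) X ^ (2 * N + 1)"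
proof (rule power2_le_imp_le)
  let ?y = "schatten n (Suc N) X"
  have "mat_pow n X (2 * N + 1) = mat_mult n (mat_pow n X N) (mat_pow n X (Suc N))"
    by (simp only: mat_pow_add[symmetric]) (simp add: mult_2)
  then have "(cmod (tr n (mat_pow n X (2 * N + 1))))\<^sup>2
      \<le> frob2 n (mat_pow n X N) * frob2 n (mat_pow n X (Suc N))"
    using tr_Cauchy_Schwarz[of "{()}" n "\<lambda>_. mat_pow n X N" "\<lambda>_. mat_pow n X (Suc N)"]
    by (simp del: mat_pow.simps)
  also have "\<dots> \<le> (3 * ?y ^ (2 * N)) * ?y ^ (2 * Suc N)"
    unfolding schatten_power[OF zero_less_Suc]
    by (intro mult_right_mono frob2_pow_pred_le assms) simp
  also have "\<dots> = 3 * (?y ^ (2 * N + 1))\<^sup>2"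
    by (simp add: power_add[symmetric] power_mult[symmetric] power2_eq_square mult_ac)
  also have "\<dots> \<le> (3 * ?y ^ (2 * N + 1))\<^sup>2"
    by (simp only: power_mult_distrib) (rule mult_right_mono; simp)
  finally show "(cmod (tr n (mat_pow n X (2 * N + 1))))\<^sup>2 \<le> (3 * ?y ^ (2 * N + 1))\<^sup>2" .
qed simp

section \<open>Gaussian integration by parts\<close>

context
  fixes s :: real
  assumes s: "0 < s"
begin

lemma prob_space_real_gauss: "prob_space (real_gauss s)"
  unfolding real_gauss_def using s by (intro prob_space_normal_density) simp

lemma real_gauss_has_moment:
  "has_bochner_integral (real_gauss s) (\<lambda>x. x ^ (2 * k)) (fact (2 * k) / ((2 / s) ^ k * fact k))"
  "has_bochner_integral (real_gauss s) (\<lambda>x. x ^ (2 * k + 1)) 0"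
proof -
  have sq: "0 < sqrt s" using s by simp
  show "has_bochner_integral (real_gauss s) (\<lambda>x. x ^ (2 * k)) (fact (2 * k) / ((2 / s) ^ k * fact k))"
    unfolding real_gauss_def
    using normal_moment_even[OF sq, of 0 k] s
    by (intro has_bochner_integral_density) (auto simp: real_sqrt_pow2)
  show "has_bochner_integral (real_gauss s) (\<lambda>x. x ^ (2 * k + 1)) 0"
    unfolding real_gauss_def
    using normal_moment_odd[OF sq, of 0 k]
    by (intro has_bochner_integral_density) auto
qed

lemma real_gauss_integrable_power: "integrable (real_gauss s) (\<lambda>x. x ^ k)"
proof (cases "even k")
  case True
  then obtain j where "k = 2 * j" by blast
  then show ?thesis using real_gauss_has_moment(1)[of j] by (simp add: has_bochner_integral_iff)
next
  case False
  then obtain j where "k = 2 * j + 1" by (rule oddE)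
  then show ?thesis using real_gauss_has_moment(2)[of j] by (simp add: has_bochner_integral_iff)
qed

text \<open>Stein's identity on monomials, read off from the explicit moments. At
  \<open>k = 0\<close> the truncated exponent is multiplied by zero.\<close>

lemma real_gauss_moment_Suc:
  "(\<integral>x. x ^ Suc k \<partial>real_gauss s) = s * real k * (\<integral>x. x ^ (k - 1) \<partial>real_gauss s)"
proof (cases "even k")
  case True
  then obtain j where k: "k = 2 * j" by blast
  have "(\<integral>x. x ^ Suc k \<partial>real_gauss s) = 0"
    using real_gauss_has_moment(2)[of j] by (simp add: k has_bochner_integral_iff)
  moreover have "(\<integral>x. x ^ (k - 1) \<partial>real_gauss s) = 0" if k0: "k \<noteq> 0"
  proof -
    obtain i where "j = Suc i" using k k0 by (cases j) auto
    then show ?thesis using real_gauss_has_moment(2)[of i] by (simp add: k has_bochner_integral_iff)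
  qed
  ultimately show ?thesis by (cases "k = 0") auto
next
  case False
  then obtain j where k: "k = 2 * j + 1" by (rule oddE)
  have "(\<integral>x. x ^ Suc k \<partial>real_gauss s) = fact (2 * Suc j) / ((2 / s) ^ Suc j * fact (Suc j))"
    using real_gauss_has_moment(1)[of "Suc j"] by (simp only: k has_bochner_integral_iff) simp
  also have "\<dots> = s * real k * (fact (2 * j) / ((2 / s) ^ j * fact j))"
  proof -
    \<comment> \<open>The new factors 2j+2 and 2j+1 of the factorial meet (2/s)(j+1) in the
      denominator and leave s(2j+1); \<open>c\<close> stands for j+1 and \<open>r\<close> for
      \<open>k\<close>.\<close>
    have *: "(2 * c) * r * A / ((2 / s) * p * (c * f)) = s * r * (A / (p * f))"
      if "0 < c" "0 < p" "0 < f" for A c f p r :: real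
      using that s by (simp add: divide_simps)
    have f: "fact (2 * Suc j) = (2 * (real j + 1)) * real k * fact (2 * j)"
      "fact (Suc j) = (real j + 1) * (fact j :: real)" by (simp_all add: k algebra_simps)
    show ?thesis unfolding f power_Suc by (rule *) (use s in auto)
  qed
  also have "fact (2 * j) / ((2 / s) ^ j * fact j) = (\<integral>x. x ^ (k - 1) \<partial>real_gauss s)"
    using real_gauss_has_moment(1)[of j] by (simp add: k has_bochner_integral_iff)
  finally show ?thesis .
qed

end

section \<open>The complex Gaussian and monomials in its real and imaginary parts\<close>

lemma integral_pair_mult:
  fixes f :: "'a \<Rightarrow> real" and g :: "'b \<Rightarrow> real"
  assumes "pair_sigma_finite M N" "integrable M f" "integrable N g"
  shows "integrable (M \<Otimes>\<^sub>M N) (\<lambda>(x, y). f x * g y)"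
    "(\<integral>(x, y). f x * g y \<partial>(M \<Otimes>\<^sub>M N)) = (\<integral>x. f x \<partial>M) * (\<integral>y. g y \<partial>N)"
proof -
  interpret pair_sigma_finite M N by fact
  have [measurable]: "f \<in> borel_measurable M" "g \<in> borel_measurable N" using assms by auto
  show i: "integrable (M \<Otimes>\<^sub>M N) (\<lambda>(x, y). f x * g y)"
  proof (rule Fubini_integrable)
    show "integrable M (\<lambda>x. \<integral>y. norm (case (x, y) of (x, y) \<Rightarrow> f x * g y) \<partial>N)"
      using assms by (simp add: abs_mult)
    show "AE x in M. integrable N (\<lambda>y. case (x, y) of (x, y) \<Rightarrow> f x * g y)"
      using assms by simp
  qed measurable
  show "(\<integral>(x, y). f x * g y \<partial>(M \<Otimes>\<^sub>M N)) = (\<integral>x. f x \<partial>M) * (\<integral>y. g y \<partial>N)"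
    using integral_fst[OF i] by simp
qed

definition re_im_pow :: "nat \<Rightarrow> nat \<Rightarrow> complex \<Rightarrow> complex" where
  "re_im_pow a b z = complex_of_real (Re z ^ a * Im z ^ b)"

lemma sets_real_gauss [measurable_cong, simp]: "sets (real_gauss s) = sets borel"
  by (simp add: real_gauss_def)

lemma measurable_Complex [measurable]: "(\<lambda>(x, y). Complex x y) \<in> borel \<Otimes>\<^sub>M borel \<rightarrow>\<^sub>M borel"
  unfolding Complex_eq by measurable

lemma measurable_Complex_gauss:
  "(\<lambda>(x, y). Complex x y) \<in> real_gauss s \<Otimes>\<^sub>M real_gauss s \<rightarrow>\<^sub>M borel"
  by measurable

lemma prob_space_cgauss:
  assumes "0 < s2" shows "prob_space (cgauss s2)"
proof -
  interpret prob_space "real_gauss (s2 / 2)" using assms by (intro prob_space_real_gauss) simp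
  interpret P: pair_prob_space "real_gauss (s2 / 2)" "real_gauss (s2 / 2)" ..
  show ?thesis unfolding cgauss_def
    by (rule P.prob_space_distr[OF measurable_Complex_gauss])
qed

lemma cgauss_re_im_pow:
  assumes s2: "0 < s2"
  shows "integrable (cgauss s2) (re_im_pow a b)"
    "(\<integral>z. re_im_pow a b z \<partial>cgauss s2)
      = complex_of_real ((\<integral>x. x ^ a \<partial>real_gauss (s2 / 2)) * (\<integral>x. x ^ b \<partial>real_gauss (s2 / 2)))"
proof -
  let ?G = "real_gauss (s2 / 2)"
  interpret prob_space ?G using s2 by (intro prob_space_real_gauss) simp
  have P: "pair_sigma_finite ?G ?G" ..
  have i: "integrable ?G (\<lambda>x. x ^ k)" for k
    using s2 by (intro real_gauss_integrable_power) simp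
  note ip = integral_pair_mult[OF P i i, of a b]
  have m: "re_im_pow a b \<in> borel_measurable borel"
    unfolding re_im_pow_def by measurable
  have eq: "(\<lambda>p. re_im_pow a b (case p of (x, y) \<Rightarrow> Complex x y))
      = (\<lambda>p. complex_of_real (case p of (x, y) \<Rightarrow> x ^ a * y ^ b))"
    by (auto simp: re_im_pow_def fun_eq_iff)
  show "integrable (cgauss s2) (re_im_pow a b)"
    unfolding cgauss_def integrable_distr_eq[OF measurable_Complex_gauss m] eq
    using ip(1) by (rule integrable_of_real)
  show "(\<integral>z. re_im_pow a b z \<partial>cgauss s2)
      = complex_of_real ((\<integral>x. x ^ a \<partial>?G) * (\<integral>x. x ^ b \<partial>?G))"
    unfolding cgauss_def integral_distr[OF measurable_Complex_gauss m] eq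
    using ip(2) by (simp del: of_real_mult)
qed

lemma mult_re_im_pow: "z * re_im_pow a b z = re_im_pow (Suc a) b z + \<i> * re_im_pow a (Suc b) z"
proof -
  have "z * re_im_pow a b z = (of_real (Re z) + \<i> * of_real (Im z)) * re_im_pow a b z"
    by (simp add: complex_eq[symmetric])
  then show ?thesis by (simp add: re_im_pow_def algebra_simps)
qed

text \<open>The right side is \<open>s2\<close> times the mean of the Wirtinger derivative (d/dx + i
  d/dy)/2 of x^a y^b. The halves come from the variance \<open>s2 / 2\<close> of each part.\<close>

lemma cgauss_integration_by_parts:
  assumes s2: "0 < s2"
  shows "integrable (cgauss s2) (\<lambda>z. z * re_im_pow a b z)"
    "(\<integral>z. z * re_im_pow a b z \<partial>cgauss s2)
       = of_real s2 * (of_nat a / 2 * (\<integral>z. re_im_pow (a - 1) b z \<partial>cgauss s2)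
           + \<i> * of_nat b / 2 * (\<integral>z. re_im_pow a (b - 1) z \<partial>cgauss s2))"
proof -
  have s: "0 < s2 / 2" using s2 by simp
  show "integrable (cgauss s2) (\<lambda>z. z * re_im_pow a b z)"
    unfolding mult_re_im_pow
    by (intro Bochner_Integration.integrable_add integrable_mult_right cgauss_re_im_pow s2)
  show "(\<integral>z. z * re_im_pow a b z \<partial>cgauss s2)
       = of_real s2 * (of_nat a / 2 * (\<integral>z. re_im_pow (a - 1) b z \<partial>cgauss s2)
           + \<i> * of_nat b / 2 * (\<integral>z. re_im_pow a (b - 1) z \<partial>cgauss s2))"
    unfolding mult_re_im_pow
    by (simp add: cgauss_re_im_pow[OF s2] real_gauss_moment_Suc[OF s] field_simps del: power_Suc)
qed

section \<open>Polynomials in a Gaussian vector: monomials and Wirtinger calculus\<close>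

definition gmono :: "nat \<Rightarrow> (nat \<Rightarrow> nat) \<Rightarrow> (nat \<Rightarrow> nat) \<Rightarrow> (nat \<Rightarrow> complex) \<Rightarrow> complex" where
  "gmono m a b g = (\<Prod>k<m. re_im_pow (a k) (b k) (g k))"

text \<open>The Wirtinger derivative of \<open>gmono\<close> in the conjugate of \<open>g l\<close>;
  a truncated exponent carries the coefficient 0.\<close>

definition dgmono :: "nat \<Rightarrow> nat \<Rightarrow> (nat \<Rightarrow> nat) \<Rightarrow> (nat \<Rightarrow> nat) \<Rightarrow> (nat \<Rightarrow> complex) \<Rightarrow> complex" where
  "dgmono m l a b g = of_nat (a l) / 2 * gmono m (a(l := a l - 1)) b g
     + \<i> * of_nat (b l) / 2 * gmono m a (b(l := b l - 1)) g"

lemma gmono_split: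
  "k < m \<Longrightarrow> gmono m a b g = re_im_pow (a k) (b k) (g k) * (\<Prod>j\<in>{..<m} - {k}. re_im_pow (a j) (b j) (g j))"
  unfolding gmono_def by (rule prod.remove) auto

lemma Re_mult_gmono: "k < m \<Longrightarrow> complex_of_real (Re (g k)) * gmono m a b g = gmono m (a(k := Suc (a k))) b g"
  by (simp add: gmono_split re_im_pow_def)

lemma Im_mult_gmono: "k < m \<Longrightarrow> complex_of_real (Im (g k)) * gmono m a b g = gmono m a (b(k := Suc (b k))) g"
  by (simp add: gmono_split re_im_pow_def)

text \<open>Product rule: Re z has derivative 1/2 in the conjugate variable; for Im z, in the next
  lemma, it is i/2.\<close>

lemma dgmono_Suc_Re:
  assumes "k < m"
  shows "dgmono m l (a(k := Suc (a k))) b g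
    = complex_of_real (Re (g k)) * dgmono m l a b g + (if k = l then gmono m a b g / 2 else 0)"
proof (cases "k = l")
  case True
  have "of_nat (a l) * gmono m a b g = of_nat (a l) * (complex_of_real (Re (g l)) * gmono m (a(l := a l - 1)) b g)"
    using assms True by (cases "a l") (simp_all add: Re_mult_gmono fun_upd_idem)
  then show ?thesis using assms True
    by (simp add: dgmono_def Re_mult_gmono[symmetric] algebra_simps add_divide_distrib)
next
  case False
  then show ?thesis using assms
    by (simp add: dgmono_def Re_mult_gmono fun_upd_twist[of k l] algebra_simps)
qed

lemma dgmono_Suc_Im:
  assumes "k < m"
  shows "dgmono m l a (b(k := Suc (b k))) g
    = complex_of_real (Im (g k)) * dgmono m l a b g + (if k = l then \<i> * gmono m a b g / 2 else 0)"
proof (cases "k = l")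
  case True
  have "of_nat (b l) * gmono m a b g = of_nat (b l) * (complex_of_real (Im (g l)) * gmono m a (b(l := b l - 1)) g)"
    using assms True by (cases "b l") (simp_all add: Im_mult_gmono fun_upd_idem)
  then show ?thesis using assms True
    by (simp add: dgmono_def Im_mult_gmono[symmetric] algebra_simps add_divide_distrib)
next
  case False
  then show ?thesis using assms
    by (simp add: dgmono_def Im_mult_gmono fun_upd_twist[of k l] algebra_simps)
qed

lemma prob_space_cgauss_vec: "0 < s2 \<Longrightarrow> prob_space (cgauss_vec s2 m)"
  unfolding cgauss_vec_def by (intro prob_space_PiM prob_space_cgauss)

text \<open>By independence the one-variable identity applies in coordinate \<open>l\<close>, the
  other factors acting as constants.\<close>

lemma gmono_integration_by_parts:
  assumes s2: "0 < s2" and l: "l < m"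
  shows "integrable (cgauss_vec s2 m) (gmono m a b)"
    and "integrable (cgauss_vec s2 m) (\<lambda>g. g l * gmono m a b g)"
    and "integrable (cgauss_vec s2 m) (dgmono m l a b)"
    and "(\<integral>g. g l * gmono m a b g \<partial>cgauss_vec s2 m) = of_real s2 * (\<integral>g. dgmono m l a b g \<partial>cgauss_vec s2 m)"
proof -
  interpret prob_space "cgauss s2" using s2 by (rule prob_space_cgauss)
  interpret product_sigma_finite "\<lambda>_::nat. cgauss s2" ..
  let ?M = "cgauss_vec s2 m"
  have i1: "integrable ?M (gmono m a b)" for a b
    unfolding gmono_def cgauss_vec_def
    by (intro product_integrable_prod cgauss_re_im_pow s2) simp
  have e1: "(\<integral>g. gmono m a b g \<partial>?M) = (\<Prod>k<m. \<integral>z. re_im_pow (a k) (b k) z \<partial>cgauss s2)" for a b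
    unfolding gmono_def cgauss_vec_def
    by (intro product_integral_prod cgauss_re_im_pow s2) simp
  have e1': "(\<integral>g. gmono m a b g \<partial>?M) = (\<integral>z. re_im_pow (a l) (b l) z \<partial>cgauss s2) *
      (\<Prod>k\<in>{..<m} - {l}. \<integral>z. re_im_pow (a k) (b k) z \<partial>cgauss s2)" for a b
    unfolding e1 using l by (intro prod.remove) auto
  define f where "f k z = (if k = l then z * re_im_pow (a k) (b k) z else re_im_pow (a k) (b k) z)" for k z
  have fi: "integrable (cgauss s2) (f k)" for k
    unfolding f_def using cgauss_integration_by_parts(1)[OF s2] cgauss_re_im_pow(1)[OF s2]
    by (cases "k = l") auto
  have f: "g l * gmono m a b g = (\<Prod>k<m. f k (g k))" for g
    using l by (simp add: gmono_split prod.remove[where x = l and A = "{..<m}"] f_def mult.assoc)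
  show "integrable ?M (gmono m a b)" by (rule i1)
  show "integrable ?M (\<lambda>g. g l * gmono m a b g)"
    unfolding f cgauss_vec_def by (intro product_integrable_prod fi) simp
  show "integrable ?M (dgmono m l a b)"
    unfolding dgmono_def[abs_def]
    by (intro Bochner_Integration.integrable_add integrable_mult_right i1)
  have "(\<integral>g. g l * gmono m a b g \<partial>?M) = (\<Prod>k<m. \<integral>z. f k z \<partial>cgauss s2)"
    unfolding f cgauss_vec_def by (intro product_integral_prod fi) simp
  also have "\<dots> = (\<integral>z. z * re_im_pow (a l) (b l) z \<partial>cgauss s2) *
      (\<Prod>k\<in>{..<m} - {l}. \<integral>z. re_im_pow (a k) (b k) z \<partial>cgauss s2)"
    using l by (simp add: prod.remove[where x = l and A = "{..<m}"] f_def)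
  also have "\<dots> = of_real s2 * (\<integral>g. dgmono m l a b g \<partial>?M)"
    unfolding dgmono_def cgauss_integration_by_parts(2)[OF s2]
    by (simp add: i1 e1' algebra_simps)
  finally show "(\<integral>g. g l * gmono m a b g \<partial>?M) = of_real s2 * (\<integral>g. dgmono m l a b g \<partial>?M)" .
qed

text \<open>\<open>wirtinger m l F F'\<close>: \<open>F\<close> is a polynomial in the real and imaginary parts of the \<open>g k\<close> for \<open>k < m\<close>,
  and \<open>F'\<close> is its Wirtinger derivative with respect to the conjugate of \<open>g l\<close>.\<close>

inductive wirtinger :: "nat \<Rightarrow> nat \<Rightarrow> ((nat \<Rightarrow> complex) \<Rightarrow> complex) \<Rightarrow> ((nat \<Rightarrow> complex) \<Rightarrow> complex) \<Rightarrow> bool"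
  for m l where
  const: "wirtinger m l (\<lambda>g. c) (\<lambda>g. 0)"
| add: "wirtinger m l F F' \<Longrightarrow> wirtinger m l H H' \<Longrightarrow> wirtinger m l (\<lambda>g. F g + H g) (\<lambda>g. F' g + H' g)"
| mult_Re: "wirtinger m l F F' \<Longrightarrow> k < m \<Longrightarrow> wirtinger m l (\<lambda>g. complex_of_real (Re (g k)) * F g)
     (\<lambda>g. complex_of_real (Re (g k)) * F' g + (if k = l then F g / 2 else 0))"
| mult_Im: "wirtinger m l F F' \<Longrightarrow> k < m \<Longrightarrow> wirtinger m l (\<lambda>g. complex_of_real (Im (g k)) * F g)
     (\<lambda>g. complex_of_real (Im (g k)) * F' g + (if k = l then \<i> * F g / 2 else 0))"

lemma wirtinger_eq:
  "wirtinger m l F F' \<Longrightarrow> (\<And>g. G g = F g) \<Longrightarrow> (\<And>g. G' g = F' g) \<Longrightarrow> wirtinger m l G G'"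
  by (metis ext)

lemma wirtinger_cmult:
  "wirtinger m l F F' \<Longrightarrow> wirtinger m l (\<lambda>g. c * F g) (\<lambda>g. c * F' g)"
proof (induction rule: wirtinger.induct)
  case (const d) show ?case by (rule wirtinger_eq[OF wirtinger.const[of m l "c * d"]]) auto
next
  case (add F F' H H')
  show ?case by (rule wirtinger_eq[OF wirtinger.add[OF add.IH]]) (auto simp: algebra_simps)
next
  case (mult_Re F F' k)
  show ?case by (rule wirtinger_eq[OF wirtinger.mult_Re[OF mult_Re.IH mult_Re.hyps(2)]]) (auto simp: algebra_simps)
next
  case (mult_Im F F' k)
  show ?case by (rule wirtinger_eq[OF wirtinger.mult_Im[OF mult_Im.IH mult_Im.hyps(2)]]) (auto simp: algebra_simps)
qed

lemma wirtinger_mult: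
  assumes "wirtinger m l F F'" and H: "wirtinger m l H H'"
  shows "wirtinger m l (\<lambda>g. F g * H g) (\<lambda>g. F' g * H g + F g * H' g)"
  using assms(1)
proof (induction rule: wirtinger.induct)
  case (const d) show ?case by (rule wirtinger_eq[OF wirtinger_cmult[OF H, of d]]) auto
next
  case (add F F' H H')
  show ?case by (rule wirtinger_eq[OF wirtinger.add[OF add.IH]]) (auto simp: algebra_simps)
next
  case (mult_Re F F' k)
  show ?case by (rule wirtinger_eq[OF wirtinger.mult_Re[OF mult_Re.IH mult_Re.hyps(2)]]) (auto simp: algebra_simps)
next
  case (mult_Im F F' k)
  show ?case by (rule wirtinger_eq[OF wirtinger.mult_Im[OF mult_Im.IH mult_Im.hyps(2)]]) (auto simp: algebra_simps)
qed

text \<open>In Re + i Im the derivatives 1/2 and i*i/2 cancel; for the conjugate, in the next lemma,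
  they add up to 1.\<close>

lemma wirtinger_var:
  assumes "k < m" shows "wirtinger m l (\<lambda>g. g k) (\<lambda>g. 0)"
  by (rule wirtinger_eq[OF wirtinger.add[OF wirtinger.mult_Re[OF wirtinger.const[of m l 1] assms]
        wirtinger.mult_Im[OF wirtinger.const[of m l \<i>] assms]]])
    (auto simp: complex_eq_iff)

lemma wirtinger_cnj:
  assumes "k < m" shows "wirtinger m l (\<lambda>g. cnj (g k)) (\<lambda>g. if k = l then 1 else 0)"
  by (rule wirtinger_eq[OF wirtinger.add[OF wirtinger.mult_Re[OF wirtinger.const[of m l 1] assms]
        wirtinger.mult_Im[OF wirtinger.const[of m l "- \<i>"] assms]]])
    (auto simp: complex_eq_iff)

lemma wirtinger_sum:
  assumes "\<And>i. i \<in> I \<Longrightarrow> wirtinger m l (F i) (F' i)"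
  shows "wirtinger m l (\<lambda>g. \<Sum>i\<in>I. F i g) (\<lambda>g. \<Sum>i\<in>I. F' i g)"
  using assms
  by (induction I rule: infinite_finite_induct) (auto intro: wirtinger.intros)

text \<open>Stein's identity for polynomials in the complex Gaussian vector; integrability is
  carried through the same induction.\<close>

lemma integration_by_parts:
  assumes s2: "0 < s2" and l: "l < m" and F: "wirtinger m l F F'"
  shows "integrable (cgauss_vec s2 m) F" "integrable (cgauss_vec s2 m) (\<lambda>g. g l * F g)"
    and "integrable (cgauss_vec s2 m) F'"
    and "(\<integral>g. g l * F g \<partial>cgauss_vec s2 m) = of_real s2 * (\<integral>g. F' g \<partial>cgauss_vec s2 m)"
proof -
  let ?M = "cgauss_vec s2 m"
  \<comment> \<open>The identity is not stable under products, so the induction carries an arbitrary monomial factor.\<close>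
  have "integrable ?M (\<lambda>g. gmono m a b g * F g) \<and> integrable ?M (\<lambda>g. g l * (gmono m a b g * F g)) \<and>
     integrable ?M (\<lambda>g. dgmono m l a b g * F g + gmono m a b g * F' g) \<and>
     (\<integral>g. g l * (gmono m a b g * F g) \<partial>?M)
       = of_real s2 * (\<integral>g. dgmono m l a b g * F g + gmono m a b g * F' g \<partial>?M)" for a b
    using F
  proof (induction arbitrary: a b rule: wirtinger.induct)
    case (const c)
    then show ?case
      using gmono_integration_by_parts[OF s2 l, of a b]
      by (simp add: mult.assoc[symmetric])
  next
    case (add F F' H H')
    have e: "dgmono m l a b g * (F g + H g) + gmono m a b g * (F' g + H' g)
       = (dgmono m l a b g * F g + gmono m a b g * F' g) + (dgmono m l a b g * H g + gmono m a b g * H' g)" for g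
      by (simp add: algebra_simps)
    show ?case using add.IH[of a b] unfolding e by (simp add: distrib_left)
  next
    case (mult_Re F F' k)
    have e1: "gmono m a b g * (complex_of_real (Re (g k)) * F g) = gmono m (a(k := Suc (a k))) b g * F g" for g
      using mult_Re.hyps by (simp add: Re_mult_gmono[symmetric])
    have e2: "dgmono m l a b g * (complex_of_real (Re (g k)) * F g) + gmono m a b g *
        (complex_of_real (Re (g k)) * F' g + (if k = l then F g / 2 else 0))
       = dgmono m l (a(k := Suc (a k))) b g * F g + gmono m (a(k := Suc (a k))) b g * F' g" for g
      using mult_Re.hyps by (simp add: Re_mult_gmono[symmetric] dgmono_Suc_Re algebra_simps)
    show ?case unfolding e1 e2 by (rule mult_Re.IH)
  next
    case (mult_Im F F' k)
    have e1: "gmono m a b g * (complex_of_real (Im (g k)) * F g) = gmono m a (b(k := Suc (b k))) g * F g" for g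
      using mult_Im.hyps by (simp add: Im_mult_gmono[symmetric])
    have e2: "dgmono m l a b g * (complex_of_real (Im (g k)) * F g) + gmono m a b g *
        (complex_of_real (Im (g k)) * F' g + (if k = l then \<i> * F g / 2 else 0))
       = dgmono m l a (b(k := Suc (b k))) g * F g + gmono m a (b(k := Suc (b k))) g * F' g" for g
      using mult_Im.hyps by (simp add: Im_mult_gmono[symmetric] dgmono_Suc_Im algebra_simps)
    show ?case unfolding e1 e2 by (rule mult_Im.IH)
  qed
  \<comment> \<open>With all exponents zero the monomial is 1 and its derivative 0.\<close>
  from this[of "\<lambda>_. 0" "\<lambda>_. 0"]
  show "integrable ?M F" "integrable ?M (\<lambda>g. g l * F g)" "integrable ?M F'"
    "(\<integral>g. g l * F g \<partial>?M) = of_real s2 * (\<integral>g. F' g \<partial>?M)"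
    by (simp_all add: gmono_def dgmono_def re_im_pow_def)
qed

section \<open>Circulant and Gram matrices\<close>

definition mat_wirtinger :: "nat \<Rightarrow> nat \<Rightarrow> nat \<Rightarrow> ((nat \<Rightarrow> complex) \<Rightarrow> cmat) \<Rightarrow> ((nat \<Rightarrow> complex) \<Rightarrow> cmat) \<Rightarrow> bool" where
  "mat_wirtinger n m l X X' \<longleftrightarrow> (\<forall>i<n. \<forall>k<n. wirtinger m l (\<lambda>g. X g i k) (\<lambda>g. X' g i k))"

text \<open>The derivative of \<open>mat_pow n X k\<close> when \<open>X'\<close> is that of
  \<open>X\<close>: the non-commutative Leibniz rule along the recursion of the power.\<close>

primrec dpow :: "nat \<Rightarrow> cmat \<Rightarrow> cmat \<Rightarrow> nat \<Rightarrow> cmat" where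
  "dpow n X X' 0 = (\<lambda>i j. 0)"
| "dpow n X X' (Suc k) = (\<lambda>i j. mat_mult n X' (mat_pow n X k) i j + mat_mult n X (dpow n X X' k) i j)"

lemma mat_wirtinger_mult:
  assumes "mat_wirtinger n m l X X'" "mat_wirtinger n m l Y Y'"
  shows "mat_wirtinger n m l (\<lambda>g. mat_mult n (X g) (Y g))
     (\<lambda>g i j. mat_mult n (X' g) (Y g) i j + mat_mult n (X g) (Y' g) i j)"
  unfolding mat_wirtinger_def
proof (intro allI impI)
  fix i k assume ik: "i < n" "k < n"
  have "wirtinger m l (\<lambda>g. \<Sum>j<n. X g i j * Y g j k) (\<lambda>g. \<Sum>j<n. X' g i j * Y g j k + X g i j * Y' g j k)"
    using assms ik by (intro wirtinger_sum wirtinger_mult) (auto simp: mat_wirtinger_def)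
  then show "wirtinger m l (\<lambda>g. mat_mult n (X g) (Y g) i k)
     (\<lambda>g. mat_mult n (X' g) (Y g) i k + mat_mult n (X g) (Y' g) i k)"
    using ik by (simp add: mat_mult_def sum.distrib)
qed

lemma mat_wirtinger_pow:
  assumes "mat_wirtinger n m l X X'"
  shows "mat_wirtinger n m l (\<lambda>g. mat_pow n (X g) k) (\<lambda>g. dpow n (X g) (X' g) k)"
proof (induction k)
  case 0
  then show ?case by (simp add: mat_wirtinger_def wirtinger.const)
next
  case (Suc k)
  then show ?case using mat_wirtinger_mult[OF assms Suc] by simp
qed

lemma mat_wirtinger_tr:
  assumes "mat_wirtinger n m l X X'"
  shows "wirtinger m l (\<lambda>g. tr n (X g)) (\<lambda>g. tr n (X' g))"
  unfolding tr_def using assms by (intro wirtinger_sum) (simp add: mat_wirtinger_def)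

lemma tr_add: "tr n (\<lambda>i j. A i j + B i j) = tr n A + tr n B"
  by (simp add: tr_def sum.distrib)

lemma mat_mult_add_right:
  "mat_mult n A (\<lambda>i j. B i j + C i j) = (\<lambda>i j. mat_mult n A B i j + mat_mult n A C i j)"
  by (intro ext) (simp add: mat_mult_def distrib_left sum.distrib)

text \<open>The derivative hits each of the \<open>k\<close> factors in turn. \<open>M\<close> is
  arbitrary in the induction and absorbs the copies of \<open>X\<close> to the left.\<close>

lemma tr_mult_dpow:
  "tr n (mat_mult n M (dpow n X X' k))
    = (\<Sum>c<k. tr n (mat_mult n M (mat_mult n (mat_pow n X c) (mat_mult n X' (mat_pow n X (k - Suc c))))))"
proof (induction k arbitrary: M)
  case 0
  then show ?case by (simp add: tr_def mat_mult_def)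
next
  case (Suc k)
  have "tr n (mat_mult n M (dpow n X X' (Suc k)))
      = tr n (mat_mult n M (mat_mult n X' (mat_pow n X k))) + tr n (mat_mult n (mat_mult n M X) (dpow n X X' k))"
    by (simp add: mat_mult_add_right tr_add mat_mult_assoc)
  then show ?case unfolding Suc sum.lessThan_Suc_shift
    by (simp add: mat_one_left mat_mult_assoc)
qed

text \<open>\<open>M\<close> will be the coefficient of \<open>g l\<close> in an expansion of one
  matrix factor. The first term of \<open>D\<close> differentiates this coefficient, the sum the
  power at position \<open>c\<close>.\<close>

lemma trace_integration_by_parts:
  fixes k :: nat
  assumes "0 < s2" "l < m" and M: "mat_wirtinger n m l M M'" and X: "mat_wirtinger n m l X X'"
  defines "D \<equiv> \<lambda>g. tr n (mat_mult n (M' g) (mat_pow n (X g) k))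
      + (\<Sum>c<k. tr n (mat_mult n (M g) (mat_mult n (mat_pow n (X g) c)
            (mat_mult n (X' g) (mat_pow n (X g) (k - Suc c))))))"
  shows "integrable (cgauss_vec s2 m) (\<lambda>g. g l * tr n (mat_mult n (M g) (mat_pow n (X g) k)))"
    and "integrable (cgauss_vec s2 m) D"
    and "(\<integral>g. g l * tr n (mat_mult n (M g) (mat_pow n (X g) k)) \<partial>cgauss_vec s2 m)
      = of_real s2 * (\<integral>g. D g \<partial>cgauss_vec s2 m)"
proof -
  have W: "wirtinger m l (\<lambda>g. tr n (mat_mult n (M g) (mat_pow n (X g) k))) D"
    using mat_wirtinger_tr[OF mat_wirtinger_mult[OF M mat_wirtinger_pow[OF X, of k]]]
    unfolding D_def tr_add tr_mult_dpow .
  note I = integration_by_parts[OF assms(1,2) W]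
  show "integrable (cgauss_vec s2 m) (\<lambda>g. g l * tr n (mat_mult n (M g) (mat_pow n (X g) k)))"
    "integrable (cgauss_vec s2 m) D"
    "(\<integral>g. g l * tr n (mat_mult n (M g) (mat_pow n (X g) k)) \<partial>cgauss_vec s2 m)
      = of_real s2 * (\<integral>g. D g \<partial>cgauss_vec s2 m)"
    by (rule I)+
qed

section \<open>Circulant indices and Gram matrices\<close>

definition cidx :: "nat \<Rightarrow> nat \<Rightarrow> nat \<Rightarrow> nat" where
  "cidx m j k = nat ((int j - int k) mod int m)"

lemma circ_eq: "circ m g j k = g (cidx m j k)"
  by (simp add: circ_def cidx_def)

lemma cidx_less: "0 < m \<Longrightarrow> cidx m j k < m"
  by (simp add: cidx_def nat_less_iff)

lemma cidx_shift:
  assumes "0 < m" shows "cidx m ((l + k) mod m) k = l mod m"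
proof -
  have "(int ((l + k) mod m) - int k) mod int m = int (l mod m)"
    by (simp add: zmod_int mod_diff_left_eq)
  then show ?thesis by (simp add: cidx_def)
qed

lemma cidx_unshift:
  assumes "0 < m" shows "(cidx m j k + k) mod m = j mod m"
proof -
  have "int ((cidx m j k + k) mod m) = int (j mod m)"
    using assms by (simp add: cidx_def zmod_int mod_add_left_eq)
  then show ?thesis by simp
qed

lemma circ_shift: "0 < m \<Longrightarrow> circ m g ((l + k) mod m) k = g (l mod m)"
  by (simp add: circ_eq cidx_shift)

text \<open>\<open>cidx\<close> inverts the cyclic shift, so a sum over rows can be rewritten as a
  sum over the index \<open>l\<close> of the Gaussian entry.\<close>

lemma sum_shift:
  fixes m :: nat
  assumes "0 < m" shows "(\<Sum>l<m. f ((l + k) mod m)) = (\<Sum>j<m. f j)"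
  by (rule sum.reindex_bij_witness[where i = "\<lambda>j. cidx m j k" and j = "\<lambda>l. (l + k) mod m"])
    (use assms in \<open>auto simp: cidx_shift cidx_unshift cidx_less\<close>)

text \<open>Entries of G* G for the circulant G of \<open>h\<close>; the restriction to
  \<open>n\<close> columns is left to the cut-off operations.\<close>

definition gram :: "nat \<Rightarrow> (nat \<Rightarrow> complex) \<Rightarrow> cmat" where
  "gram m h i k = (\<Sum>j<m. cnj (circ m h j i) * circ m h j k)"

lemma adj_gram: "adj (gram m h) = gram m h"
  by (simp add: adj_def gram_def mult.commute fun_eq_iff)

text \<open>The substitution j = l + i isolates the conjugated entry, for differentiation; j = l + k
  in the next lemma isolates the plain one, for the expansion.\<close>

lemma gram_shift_left:
  assumes "0 < m"
  shows "gram m h i k = (\<Sum>l<m. cnj (h l) * circ m h ((l + i) mod m) k)"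
  unfolding gram_def
  by (subst sum_shift[OF assms, of _ i, symmetric], rule sum.cong)
    (use assms in \<open>auto simp: circ_shift\<close>)

lemma gram_shift_right:
  assumes "0 < m"
  shows "gram m h i k = (\<Sum>l<m. h l * cnj (circ m h ((l + k) mod m) i))"
  unfolding gram_def
  by (subst sum_shift[OF assms, of _ k, symmetric], rule sum.cong)
    (use assms in \<open>auto simp: circ_shift mult.commute\<close>)

definition circ_vec :: "nat \<Rightarrow> nat \<Rightarrow> (nat \<Rightarrow> complex) \<Rightarrow> (nat \<Rightarrow> complex) \<Rightarrow> nat \<Rightarrow> complex" where
  "circ_vec m n h x j = (\<Sum>k<n. circ m h j k * x k)"

lemma vnorm2_circ_vec:
  "complex_of_real (vnorm2 m (circ_vec m n h x)) = (\<Sum>i<n. cnj (x i) * mat_vec n (gram m h) x i)"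
proof -
  have "complex_of_real (vnorm2 m (circ_vec m n h x))
      = (\<Sum>j<m. cnj (circ_vec m n h x j) * circ_vec m n h x j)"
    by (simp add: vnorm2_def complex_norm_square mult.commute del: of_real_power)
  also have "\<dots> = (\<Sum>j<m. \<Sum>i<n. \<Sum>k<n. cnj (x i) * (cnj (circ m h j i) * circ m h j k * x k))"
    by (simp add: circ_vec_def sum_product mult.assoc mult.left_commute)
  also have "\<dots> = (\<Sum>i<n. \<Sum>k<n. \<Sum>j<m. cnj (x i) * (cnj (circ m h j i) * circ m h j k * x k))"
    by (subst sum.swap) (intro sum.cong refl sum.swap)
  also have "\<dots> = (\<Sum>i<n. cnj (x i) * mat_vec n (gram m h) x i)"
    by (simp add: mat_vec_def gram_def sum_distrib_left sum_distrib_right)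
  finally show ?thesis .
qed

text \<open>The squared norm is the Hermitian form of the Gram matrix at \<open>x\<close>.\<close>

lemma vnorm2_circ_vec_le:
  assumes "0 < Q"
  shows "vnorm2 m (circ_vec m n h x) \<le> schatten n Q (gram m h) * vnorm2 n x"
proof -
  have "vnorm2 m (circ_vec m n h x) = cmod (complex_of_real (vnorm2 m (circ_vec m n h x)))" by simp
  also have "\<dots> \<le> schatten n Q (gram m h) * sqrt (vnorm2 n (\<lambda>i. cnj (x i)) * vnorm2 n x)"
    unfolding vnorm2_circ_vec by (rule form_le_schatten[OF adj_gram assms])
  also have "vnorm2 n (\<lambda>i. cnj (x i)) = vnorm2 n x" by (simp add: vnorm2_def)
  finally show ?thesis by simp
qed

text \<open>Reversing the order of the entries of \<open>x\<close> turns the correlation with \<open>h\<close> into a convolution.\<close>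

lemma vnorm2_hankel_le:
  assumes "0 < Q" "0 < m" "0 < n"
  shows "(\<Sum>l<m. (cmod (\<Sum>k<n. h ((l + k) mod m) * x k))\<^sup>2) \<le> schatten n Q (gram m h) * vnorm2 n x"
proof -
  define x' where "x' k = x (n - Suc k)" for k
  have "(\<Sum>k<n. h ((l + k) mod m) * x k) = circ_vec m n h x' ((l + (n - 1)) mod m)" for l
  proof -
    have "(\<Sum>k<n. h ((l + k) mod m) * x k) = (\<Sum>k<n. h ((l + (n - Suc k)) mod m) * x' k)"
      unfolding x'_def by (rule sum.nat_diff_reindex[symmetric])
    also have "\<dots> = circ_vec m n h x' ((l + (n - 1)) mod m)"
      unfolding circ_vec_def
    proof (rule sum.cong)
      fix k assume "k \<in> {..<n}"
      then have "l + (n - 1) = (l + (n - Suc k)) + k" by simp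
      then show "h ((l + (n - Suc k)) mod m) * x' k = circ m h ((l + (n - 1)) mod m) k * x' k"
        by (simp only: circ_shift[OF \<open>0 < m\<close>])
    qed simp
    finally show ?thesis .
  qed
  then have "(\<Sum>l<m. (cmod (\<Sum>k<n. h ((l + k) mod m) * x k))\<^sup>2) = vnorm2 m (circ_vec m n h x')"
    unfolding vnorm2_def
    using sum_shift[OF \<open>0 < m\<close>, of "\<lambda>j. (cmod (circ_vec m n h x' j))\<^sup>2" "n - 1"] by simp
  also have "\<dots> \<le> schatten n Q (gram m h) * vnorm2 n x'"
    by (rule vnorm2_circ_vec_le) fact
  also have "vnorm2 n x' = vnorm2 n x"
    unfolding vnorm2_def x'_def by (rule sum.nat_diff_reindex)
  finally show ?thesis .
qed

section \<open>Moments of weighted Gram matrices\<close>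

text \<open>Half of the integral is absorbed into the left side; integrability of \<open>f\<close>
  makes the subtraction legitimate.\<close>

lemma integral_le_of_self_bound:
  fixes f u :: "'a \<Rightarrow> real" and D :: "'a \<Rightarrow> complex"
  assumes "integrable M f" "integrable M u" "integrable M D"
    and eq: "(\<integral>x. f x \<partial>M) = Re (\<integral>x. D x \<partial>M)"
    and le: "\<And>x. cmod (D x) \<le> f x / 2 + u x"
  shows "(\<integral>x. f x \<partial>M) \<le> 2 * (\<integral>x. u x \<partial>M)"
proof -
  have "Re (\<integral>x. D x \<partial>M) = (\<integral>x. Re (D x) \<partial>M)" using assms(3) by simp
  also have "\<dots> \<le> (\<integral>x. f x / 2 + u x \<partial>M)"
    using assms by (intro integral_mono) (auto intro: order_trans[OF complex_Re_le_cmod])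
  also have "\<dots> = (\<integral>x. f x \<partial>M) / 2 + (\<integral>x. u x \<partial>M)" using assms by simp
  finally show ?thesis using eq by simp
qed

lemma sum_shift2:
  fixes f :: "nat \<Rightarrow> real"
  assumes "0 < m" shows "(\<Sum>l<m. \<Sum>i<n. f ((l + i) mod m)) = real n * (\<Sum>j<m. f j)"
  by (subst sum.swap) (simp add: sum_shift[OF assms])

lemma tr_mult_decompose:
  assumes "\<And>i k. i < n \<Longrightarrow> k < n \<Longrightarrow> A i k = (\<Sum>l\<in>L. c l * M l i k)"
  shows "tr n (mat_mult n A Y) = (\<Sum>l\<in>L. c l * tr n (mat_mult n (M l) Y))"
proof -
  have "tr n (mat_mult n A Y) = (\<Sum>i<n. \<Sum>j<n. \<Sum>l\<in>L. c l * (M l i j * Y j i))"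
    by (simp add: tr_mult assms sum_distrib_right mult.assoc)
  also have "\<dots> = (\<Sum>i<n. \<Sum>l\<in>L. \<Sum>j<n. c l * (M l i j * Y j i))"
    by (intro sum.cong refl sum.swap)
  also have "\<dots> = (\<Sum>l\<in>L. \<Sum>i<n. \<Sum>j<n. c l * (M l i j * Y j i))" by (rule sum.swap)
  finally show ?thesis by (simp add: tr_mult sum_distrib_left)
qed

lemma wirtinger_circ:
  assumes "0 < m" shows "wirtinger m l (\<lambda>g. circ m (\<lambda>j. \<beta> j * g j) j k) (\<lambda>g. 0)"
  unfolding circ_eq
  by (rule wirtinger_eq[OF wirtinger_cmult[OF wirtinger_var[OF cidx_less[OF assms]]]]) auto

lemma wirtinger_cnj_circ:
  assumes "0 < m"
  shows "wirtinger m l (\<lambda>g. cnj (circ m (\<lambda>j. \<beta> j * g j) j k)) (\<lambda>g. if cidx m j k = l then cnj (\<beta> l) else 0)"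
  unfolding circ_eq
  by (rule wirtinger_eq[OF wirtinger_cmult[OF wirtinger_cnj[OF cidx_less[OF assms]]]]) auto

text \<open>The coefficient of \<open>g l\<close> in the weighted Gram matrix. It contains only
  conjugated entries, and its adjoint is the derivative of the Gram matrix.\<close>

definition gram_part :: "nat \<Rightarrow> (nat \<Rightarrow> complex) \<Rightarrow> nat \<Rightarrow> (nat \<Rightarrow> complex) \<Rightarrow> cmat" where
  "gram_part m \<beta> l g = (\<lambda>i k. \<beta> l * cnj (circ m (\<lambda>j. \<beta> j * g j) ((l + k) mod m) i))"

lemma gram_decompose:
  "0 < m \<Longrightarrow> gram m (\<lambda>j. \<beta> j * g j) i k = (\<Sum>l<m. g l * gram_part m \<beta> l g i k)"
  by (simp add: gram_shift_right gram_part_def mult_ac)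

lemma mat_wirtinger_gram:
  assumes "0 < m" "l < m"
  shows "mat_wirtinger n m l (\<lambda>g. gram m (\<lambda>j. \<beta> j * g j)) (\<lambda>g. adj (gram_part m \<beta> l g))"
  unfolding mat_wirtinger_def
proof (intro allI impI)
  fix i k
  have "wirtinger m l (\<lambda>g. \<Sum>l'<m. cnj (\<beta> l') * cnj (g l') * circ m (\<lambda>j. \<beta> j * g j) ((l' + i) mod m) k)
    (\<lambda>g. \<Sum>l'<m. cnj (\<beta> l') * (if l' = l then 1 else 0) * circ m (\<lambda>j. \<beta> j * g j) ((l' + i) mod m) k
       + cnj (\<beta> l') * cnj (g l') * 0)"
    by (intro wirtinger_sum wirtinger_mult wirtinger_circ wirtinger_cmult wirtinger_cnj) (use assms in auto)
  then show "wirtinger m l (\<lambda>g. gram m (\<lambda>j. \<beta> j * g j) i k) (\<lambda>g. adj (gram_part m \<beta> l g) i k)"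
    by (rule wirtinger_eq) (use assms in \<open>auto simp: gram_shift_left adj_def gram_part_def
        if_distrib[of "\<lambda>x. _ * x"] if_distrib[of "\<lambda>x. x * _"] sum.delta cong: if_cong\<close>)
qed

text \<open>Indices below \<open>m\<close> are distinct residues. This makes the derivative of
  \<open>gram_part\<close> a multiple of the identity.\<close>

lemma cidx_shift_eq_iff:
  assumes "0 < m" "l < m" "i < m" "k < m"
  shows "cidx m ((l + k) mod m) i = l \<longleftrightarrow> i = k"
proof
  assume "cidx m ((l + k) mod m) i = l"
  then have eq: "(l + i) mod m = (l + k) mod m"
    using cidx_unshift[OF assms(1), of "(l + k) mod m" i] by simp
  show "i = k"
  proof (cases "i \<le> k")
    case True
    then have "m dvd (l + k) - (l + i)" using eq by (metis mod_eq_dvd_iff_nat add_left_mono)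
    then show ?thesis using True assms by (auto dest: dvd_imp_le)
  next
    case False
    then have "m dvd (l + i) - (l + k)" using eq by (metis mod_eq_dvd_iff_nat add_left_mono nat_le_linear)
    then show ?thesis using False assms by (auto dest: dvd_imp_le)
  qed
qed (use assms in \<open>auto simp: cidx_shift\<close>)

lemma mat_wirtinger_gram_part:
  assumes "0 < m" "l < m" "n \<le> m"
  shows "mat_wirtinger n m l (gram_part m \<beta> l) (\<lambda>g i k. of_real ((cmod (\<beta> l))\<^sup>2) * mat_one n i k)"
  unfolding mat_wirtinger_def
proof (intro allI impI)
  fix i k assume ik: "i < n" "k < n"
  show "wirtinger m l (\<lambda>g. gram_part m \<beta> l g i k) (\<lambda>g. of_real ((cmod (\<beta> l))\<^sup>2) * mat_one n i k)"
    unfolding gram_part_def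
    by (rule wirtinger_eq[OF wirtinger_cmult[OF wirtinger_cnj_circ]])
      (use assms ik in \<open>auto simp: cidx_shift_eq_iff mat_one_def complex_norm_square simp del: of_real_power\<close>)
qed

text \<open>Write h for \<open>\<beta> * g\<close>. After a shift of \<open>l\<close> by
  \<open>i\<close>, row \<open>i\<close> of the family is a Hankel sum of h; row \<open>i\<close> of
  the adjoint is a weight times entry l + i of the circulant of h applied to \<open>x\<close>. The
  \<open>n\<close> rows give the factor \<open>n\<close>.\<close>

lemma family_bound_gram_part:
  assumes "0 < m" "0 < n" "0 < Q" and B: "\<And>l. l < m \<Longrightarrow> cmod (\<beta> l) \<le> B"
  shows "family_bound n {..<m} (B\<^sup>2 * real n * schatten n Q (gram m (\<lambda>j. \<beta> j * g j))) (\<lambda>l. gram_part m \<beta> l g)"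
    and "family_bound n {..<m} (B\<^sup>2 * real n * schatten n Q (gram m (\<lambda>j. \<beta> j * g j))) (\<lambda>l. adj (gram_part m \<beta> l g))"
proof -
  define h where "h j = \<beta> j * g j" for j
  let ?y = "schatten n Q (gram m h)"
  have B2: "(cmod (\<beta> l))\<^sup>2 \<le> B\<^sup>2" if "l < m" for l using B[OF that] by (simp add: power_mono)
  have 1: "(\<Sum>l<m. vnorm2 n (mat_vec n (gram_part m \<beta> l g) x)) \<le> B\<^sup>2 * real n * ?y * vnorm2 n x" for x
  proof -
    let ?f = "\<lambda>l i. (cmod (\<Sum>k<n. circ m h ((l + k) mod m) i * cnj (x k)))\<^sup>2"
    have "(cmod (mat_vec n (gram_part m \<beta> l g) x i))\<^sup>2 \<le> B\<^sup>2 * ?f l i" if "l < m" for l i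
    proof -
      have e: "mat_vec n (gram_part m \<beta> l g) x i = \<beta> l * cnj (\<Sum>k<n. circ m h ((l + k) mod m) i * cnj (x k))"
        by (simp add: mat_vec_def gram_part_def sum_distrib_left mult.assoc h_def[abs_def])
      show ?thesis unfolding e norm_mult complex_mod_cnj power_mult_distrib
        by (intro mult_right_mono B2 that) simp
    qed
    then have "(\<Sum>l<m. vnorm2 n (mat_vec n (gram_part m \<beta> l g) x)) \<le> (\<Sum>l<m. \<Sum>i<n. B\<^sup>2 * ?f l i)"
      unfolding vnorm2_def by (intro sum_mono) simp
    also have "\<dots> = B\<^sup>2 * (\<Sum>i<n. \<Sum>l<m. ?f l i)"
      by (subst sum.swap) (simp add: sum_distrib_left)
    also have "\<dots> \<le> B\<^sup>2 * (\<Sum>i<n. ?y * vnorm2 n (\<lambda>k. cnj (x k)))"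
    proof (intro mult_left_mono sum_mono)
      fix i
      have c: "circ m h (((l + i) mod m + k) mod m) i = h ((l + k) mod m)" for l k
      proof -
        have "((l + i) mod m + k) mod m = ((l + k) + i) mod m"
          unfolding mod_add_left_eq by (simp add: ac_simps)
        then show ?thesis by (simp only: circ_shift[OF \<open>0 < m\<close>])
      qed
      have "(\<Sum>l<m. ?f l i) = (\<Sum>l<m. ?f ((l + i) mod m) i)"
        by (rule sum_shift[OF \<open>0 < m\<close>, symmetric])
      also have "\<dots> \<le> ?y * vnorm2 n (\<lambda>k. cnj (x k))"
        unfolding c by (rule vnorm2_hankel_le) fact+
      finally show "(\<Sum>l<m. ?f l i) \<le> ?y * vnorm2 n (\<lambda>k. cnj (x k))" .
    qed simp
    finally show ?thesis by (simp add: vnorm2_def)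
  qed
  have 2: "(\<Sum>l<m. vnorm2 n (mat_vec n (adj (gram_part m \<beta> l g)) x)) \<le> B\<^sup>2 * real n * ?y * vnorm2 n x" for x
  proof -
    let ?f = "\<lambda>j. B\<^sup>2 * (cmod (circ_vec m n h x j))\<^sup>2"
    have "(cmod (mat_vec n (adj (gram_part m \<beta> l g)) x i))\<^sup>2 \<le> ?f ((l + i) mod m)" if "l < m" for l i
    proof -
      have "mat_vec n (adj (gram_part m \<beta> l g)) x i = cnj (\<beta> l) * circ_vec m n h x ((l + i) mod m)"
        by (simp add: mat_vec_def gram_part_def adj_def circ_vec_def sum_distrib_left mult.assoc h_def[abs_def])
      then show ?thesis using B2[OF that] by (simp add: norm_mult power_mult_distrib mult_right_mono)
    qed
    then have "(\<Sum>l<m. vnorm2 n (mat_vec n (adj (gram_part m \<beta> l g)) x)) \<le> (\<Sum>l<m. \<Sum>i<n. ?f ((l + i) mod m))"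
      unfolding vnorm2_def by (intro sum_mono) simp
    also have "\<dots> = B\<^sup>2 * real n * vnorm2 m (circ_vec m n h x)"
      by (subst sum_shift2[OF \<open>0 < m\<close>]) (simp add: vnorm2_def sum_distrib_left mult_ac)
    also have "\<dots> \<le> B\<^sup>2 * real n * (?y * vnorm2 n x)"
      by (intro mult_left_mono vnorm2_circ_vec_le) (use assms in auto)
    finally show ?thesis by (simp add: mult.assoc)
  qed
  show "family_bound n {..<m} (B\<^sup>2 * real n * schatten n Q (gram m (\<lambda>j. \<beta> j * g j))) (\<lambda>l. gram_part m \<beta> l g)"
    "family_bound n {..<m} (B\<^sup>2 * real n * schatten n Q (gram m (\<lambda>j. \<beta> j * g j))) (\<lambda>l. adj (gram_part m \<beta> l g))"
    using 1 2 by (auto simp: family_bound_def h_def[abs_def])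
qed

lemma tr_scaled_one_mult_pow:
  "tr n (mat_mult n (\<lambda>i k. c * mat_one n i k) (mat_pow n X k)) = c * tr n (mat_pow n X k)"
  using tr_mult_decompose[where A = "\<lambda>i k. c * mat_one n i k" and L = "{()}" and c = "\<lambda>_. c"
      and M = "\<lambda>_. mat_one n" and Y = "mat_pow n X k" and n = n]
  by (simp add: mat_one_mult_pow)

text \<open>Expand one factor of the trace of K^(2Q), \<open>Q = Suc N\<close>, and integrate by
  parts. Differentiating the coefficient gives an odd trace with weights summing to at most m B^2;
  each of the other 2Q - 1 factors gives a word with \<open>\<Theta>\<close> = B^2 n y, where y is
  the norm of K itself. Both are of order y^(2Q-1), so the estimate closes up.\<close>

lemma gram_moment:
  assumes s2: "0 < s2" and n: "0 < n" "n \<le> m" "real n \<le> 3 ^ Suc N"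
    and B0: "0 < B" and B: "\<And>l. l < m \<Longrightarrow> cmod (\<beta> l) \<le> B"
    and \<Lambda>: "\<Lambda> = 6 * s2 * B\<^sup>2 * (real m + 2 * real (Suc N) * real n)"
  shows "integrable (cgauss_vec s2 m) (\<lambda>g. frob2 n (mat_pow n (gram m (\<lambda>j. \<beta> j * g j)) (Suc N)))"
    and "(\<integral>g. frob2 n (mat_pow n (gram m (\<lambda>j. \<beta> j * g j)) (Suc N)) \<partial>cgauss_vec s2 m) \<le> \<Lambda> ^ (2 * Suc N)"
proof -
  have m: "0 < m" using n by simp
  let ?M = "cgauss_vec s2 m"
  interpret prob_space ?M by (rule prob_space_cgauss_vec[OF s2])
  define K where "K g = gram m (\<lambda>j. \<beta> j * g j)" for g
  define P where "P l g = gram_part m \<beta> l g" for l g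
  define y where "y g = schatten n (Suc N) (K g)" for g
  define D where "D l g = tr n (mat_mult n (\<lambda>i k. of_real ((cmod (\<beta> l))\<^sup>2) * mat_one n i k) (mat_pow n (K g) (2 * N + 1)))
      + (\<Sum>c<2 * N + 1. tr n (mat_mult n (P l g) (mat_mult n (mat_pow n (K g) c)
            (mat_mult n (adj (P l g)) (mat_pow n (K g) (2 * N + 1 - Suc c))))))" for l g
  have K: "adj (K g) = K g" for g by (simp add: K_def adj_gram)
  have y: "0 \<le> y g" "y g ^ (2 * Suc N) = frob2 n (mat_pow n (K g) (Suc N))" for g
    unfolding y_def by (rule schatten_nonneg, rule schatten_power) simp
  have \<Lambda>0: "0 < \<Lambda>" unfolding \<Lambda> using s2 B0 m by (intro mult_pos_pos add_pos_nonneg) auto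
  have ibp: "integrable ?M (\<lambda>g. g l * tr n (mat_mult n (P l g) (mat_pow n (K g) (2 * N + 1))))"
    "integrable ?M (D l)"
    "(\<integral>g. g l * tr n (mat_mult n (P l g) (mat_pow n (K g) (2 * N + 1))) \<partial>?M)
      = of_real s2 * (\<integral>g. D l g \<partial>?M)" if "l < m" for l
    unfolding P_def K_def D_def
    by (rule trace_integration_by_parts[OF s2 that mat_wirtinger_gram_part[OF m that n(2)]
          mat_wirtinger_gram[OF m that]])+
  have exp: "complex_of_real (frob2 n (mat_pow n (K g) (Suc N)))
      = (\<Sum>l<m. g l * tr n (mat_mult n (P l g) (mat_pow n (K g) (2 * N + 1))))" for g
  proof -
    have "complex_of_real (frob2 n (mat_pow n (K g) (Suc N))) = tr n (mat_mult n (K g) (mat_pow n (K g) (2 * N + 1)))"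
      using tr_pow_even[OF K, of n g "Suc N"] by simp
    also have "\<dots> = (\<Sum>l<m. g l * tr n (mat_mult n (P l g) (mat_pow n (K g) (2 * N + 1))))"
      by (rule tr_mult_decompose) (simp add: K_def P_def gram_decompose[OF m])
    finally show ?thesis .
  qed
  have int_c: "integrable ?M (\<lambda>g. complex_of_real (frob2 n (mat_pow n (K g) (Suc N))))"
    unfolding exp by (intro Bochner_Integration.integrable_sum ibp) simp
  then have int: "integrable ?M (\<lambda>g. frob2 n (mat_pow n (K g) (Suc N)))"
    using integrable_Re[OF int_c] by simp
  have bound: "cmod (of_real s2 * (\<Sum>l<m. D l g)) \<le> frob2 n (mat_pow n (K g) (Suc N)) / 2 + \<Lambda> ^ (2 * Suc N) / 2" for g
  proof -
    let ?T = "B\<^sup>2 * real n * y g"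
    have T0: "0 \<le> ?T" using y by simp
    have fb: "family_bound n {..<m} ?T (\<lambda>l. P l g)" "family_bound n {..<m} ?T (\<lambda>l. adj (P l g))"
      unfolding P_def y_def K_def by (rule family_bound_gram_part; use m n B in simp)+
    have S: "(\<Sum>l<m. D l g) = (\<Sum>l<m. of_real ((cmod (\<beta> l))\<^sup>2)) * tr n (mat_pow n (K g) (2 * N + 1))
      + (\<Sum>c<2 * N + 1. \<Sum>l<m. tr n (mat_mult n (P l g) (mat_mult n (mat_pow n (K g) c)
            (mat_mult n (adj (P l g)) (mat_pow n (K g) (2 * N + 1 - Suc c))))))"
      unfolding D_def sum.distrib tr_scaled_one_mult_pow
      by (subst sum.swap[of _ _ "{..<m}"]) (simp only: sum_distrib_right)
    have "cmod (\<Sum>l<m. D l g) \<le> real m * B\<^sup>2 * (3 * y g ^ (2 * N + 1)) + (\<Sum>c<2 * N + 1. ?T * (3 * y g ^ (2 * N)))"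
      unfolding S
    proof (intro norm_triangle_le add_mono sum_norm_le)
      have "cmod (\<Sum>l<m. of_real ((cmod (\<beta> l))\<^sup>2)) \<le> (\<Sum>l<m. B\<^sup>2)"
        by (rule sum_norm_le) (use B in \<open>simp add: norm_power power_mono\<close>)
      then show "cmod ((\<Sum>l<m. of_real ((cmod (\<beta> l))\<^sup>2)) * tr n (mat_pow n (K g) (2 * N + 1)))
          \<le> real m * B\<^sup>2 * (3 * y g ^ (2 * N + 1))"
        unfolding norm_mult y_def by (intro mult_mono tr_pow_odd_le K n(3)) auto
      fix c assume c: "c \<in> {..<2 * N + 1}"
      \<comment> \<open>The two powers in the word add up to 2N for every position
        \<open>c\<close>.\<close>
      have "cmod (\<Sum>l<m. tr n (mat_mult n (P l g) (mat_mult n (mat_pow n (K g) c)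
            (mat_mult n (adj (P l g)) (mat_pow n (K g) (2 * N + 1 - Suc c)))))) \<le> ?T * frob2 n (mat_pow n (K g) N)"
        by (rule family_bound_tr_le[OF K finite_lessThan T0 fb fb(2)]) (use c in \<open>simp_all add: fb\<close>)
      also have "\<dots> \<le> ?T * (3 * y g ^ (2 * N))"
        by (rule mult_left_mono[OF _ T0]) (unfold y_def, rule frob2_pow_pred_le[OF K n(3)])
      finally show "cmod (\<Sum>l<m. tr n (mat_mult n (P l g) (mat_mult n (mat_pow n (K g) c)
            (mat_mult n (adj (P l g)) (mat_pow n (K g) (2 * N + 1 - Suc c)))))) \<le> ?T * (3 * y g ^ (2 * N))" .
    qed
    also have "\<dots> = 3 * B\<^sup>2 * (real m + (2 * real N + 1) * real n) * y g ^ (2 * N + 1)"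
      by (simp add: algebra_simps)
    also have "\<dots> \<le> 3 * B\<^sup>2 * (real m + 2 * real (Suc N) * real n) * y g ^ (2 * N + 1)"
      by (intro mult_right_mono mult_left_mono add_left_mono) (use y in auto)
    finally have "cmod (of_real s2 * (\<Sum>l<m. D l g)) \<le> s2 * (3 * B\<^sup>2 * (real m + 2 * real (Suc N) * real n) * y g ^ (2 * N + 1))"
      unfolding norm_mult using s2 by (simp add: mult_left_mono)
    \<comment> \<open>The 6 in \<open>\<Lambda>\<close> is twice the 3 above. The split with
      \<open>x = 1\<close> and weight \<open>\<Lambda>\<close> then leaves exactly half of y^(2Q) to
      absorb.\<close>
    also have "\<dots> = \<Lambda> / 2 * (1 * y g ^ (2 * N + 1))" by (simp add: \<Lambda>)
    also have "\<dots> \<le> \<Lambda> / 2 * (\<Lambda> ^ (2 * N + 1) * 1 ^ Suc (2 * N + 1) + y g ^ Suc (2 * N + 1) / \<Lambda>)"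
      by (intro mult_left_mono mult_power_le_split) (use y \<Lambda>0 in auto)
    also have "\<dots> = frob2 n (mat_pow n (K g) (Suc N)) / 2 + \<Lambda> ^ (2 * Suc N) / 2"
      unfolding y(2)[symmetric] using \<Lambda>0 by (simp add: field_simps)
    finally show ?thesis .
  qed
  have "(\<integral>g. frob2 n (mat_pow n (K g) (Suc N)) \<partial>?M) \<le> 2 * (\<integral>g. \<Lambda> ^ (2 * Suc N) / 2 \<partial>?M)"
  proof (rule integral_le_of_self_bound[OF int _ _ _ bound])
    show "integrable ?M (\<lambda>g. of_real s2 * (\<Sum>l<m. D l g))"
      by (intro integrable_mult_right Bochner_Integration.integrable_sum ibp) simp
    have "complex_of_real (\<integral>g. frob2 n (mat_pow n (K g) (Suc N)) \<partial>?M)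
        = (\<integral>g. complex_of_real (frob2 n (mat_pow n (K g) (Suc N))) \<partial>?M)" by simp
    also have "\<dots> = (\<Sum>l<m. \<integral>g. g l * tr n (mat_mult n (P l g) (mat_pow n (K g) (2 * N + 1))) \<partial>?M)"
      unfolding exp by (rule Bochner_Integration.integral_sum, rule ibp(1), simp)
    also have "\<dots> = (\<Sum>l<m. of_real s2 * (\<integral>g. D l g \<partial>?M))"
      by (rule sum.cong[OF refl], rule ibp(3), simp)
    also have "\<dots> = (\<integral>g. of_real s2 * (\<Sum>l<m. D l g) \<partial>?M)"
      by (simp add: ibp sum_distrib_left)
    finally show "(\<integral>g. frob2 n (mat_pow n (K g) (Suc N)) \<partial>?M) = Re (\<integral>g. of_real s2 * (\<Sum>l<m. D l g) \<partial>?M)"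
      by (metis Re_complex_of_real)
  qed simp
  also have "\<dots> = \<Lambda> ^ (2 * Suc N)" using prob_space by simp
  finally show "(\<integral>g. frob2 n (mat_pow n (gram m (\<lambda>j. \<beta> j * g j)) (Suc N)) \<partial>?M) \<le> \<Lambda> ^ (2 * Suc N)"
    by (simp only: K_def)
  show "integrable ?M (\<lambda>g. frob2 n (mat_pow n (gram m (\<lambda>j. \<beta> j * g j)) (Suc N)))"
    using int by (simp only: K_def)
qed

section \<open>The Gaussian chaos\<close>

text \<open>This is G^T diag(d) G with the plain transpose; the factor 1/m will be part of
  \<open>d\<close>.\<close>

definition chaos :: "nat \<Rightarrow> (nat \<Rightarrow> complex) \<Rightarrow> (nat \<Rightarrow> complex) \<Rightarrow> cmat" where
  "chaos m d g = (\<lambda>i k. \<Sum>j<m. d j * circ m g j i * circ m g j k)"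

text \<open>Both \<open>chaos\<close> and \<open>herm_chaos\<close> are symmetric, so the latter is twice the entrywise real part; the
  imaginary part is recovered by replacing \<open>d\<close> with \<open>\<i> * d\<close>, which avoids a block dilation.\<close>

definition herm_chaos :: "nat \<Rightarrow> (nat \<Rightarrow> complex) \<Rightarrow> (nat \<Rightarrow> complex) \<Rightarrow> cmat" where
  "herm_chaos m d g = (\<lambda>i k. chaos m d g i k + adj (chaos m d g) i k)"

text \<open>The coefficient left when the first factor \<open>g l\<close> is taken out; it is linear
  in \<open>g\<close> without conjugates.\<close>

definition chaos_part :: "nat \<Rightarrow> (nat \<Rightarrow> complex) \<Rightarrow> nat \<Rightarrow> (nat \<Rightarrow> complex) \<Rightarrow> cmat" where
  "chaos_part m d l g = (\<lambda>i k. d ((l + i) mod m) * circ m g ((l + i) mod m) k)"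

definition mat_cnj :: "cmat \<Rightarrow> cmat" where
  "mat_cnj A = (\<lambda>i k. cnj (A i k))"

lemma adj_herm_chaos: "adj (herm_chaos m d g) = herm_chaos m d g"
  by (simp add: herm_chaos_def adj_def add.commute)

lemma chaos_decompose:
  assumes "0 < m" shows "chaos m d g i k = (\<Sum>l<m. g l * chaos_part m d l g i k)"
  unfolding chaos_def
  by (subst sum_shift[OF assms, of _ i, symmetric], rule sum.cong)
    (use assms in \<open>auto simp: circ_shift chaos_part_def\<close>)

lemma wirtinger_circ_id: "0 < m \<Longrightarrow> wirtinger m l (\<lambda>g. circ m g j k) (\<lambda>g. 0)"
  using wirtinger_circ[where \<beta> = "\<lambda>_. 1"] by simp

lemma wirtinger_cnj_circ_id:
  "0 < m \<Longrightarrow> wirtinger m l (\<lambda>g. cnj (circ m g j k)) (\<lambda>g. if cidx m j k = l then 1 else 0)"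
  by (rule wirtinger_eq[OF wirtinger_cnj_circ[where \<beta> = "\<lambda>_. 1"]]) auto

lemma mat_wirtinger_chaos_part:
  "0 < m \<Longrightarrow> mat_wirtinger n m l (chaos_part m d l) (\<lambda>g i k. 0)"
  unfolding mat_wirtinger_def chaos_part_def
  by (intro allI impI, rule wirtinger_eq[OF wirtinger_cmult[OF wirtinger_circ_id]]) auto

lemma sum_cidx_delta:
  assumes "0 < m" "l < m"
  shows "(\<Sum>j<m. if cidx m j k = l then f j else 0) = f ((l + k) mod m)"
proof -
  have "(\<Sum>j<m. if cidx m j k = l then f j else 0) = (\<Sum>l'<m. if l' = l then f ((l' + k) mod m) else 0)"
    by (subst sum_shift[OF assms(1), of _ k, symmetric], rule sum.cong)
      (use assms in \<open>auto simp: cidx_shift\<close>)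
  then show ?thesis using assms by (simp add: sum.delta)
qed

text \<open>The chaos is free of conjugates and contributes nothing. Its adjoint has two conjugated
  factors: hitting one gives the adjoint of \<open>chaos_part\<close>, hitting the other its
  entrywise conjugate.\<close>

lemma mat_wirtinger_herm_chaos:
  assumes "0 < m" "l < m"
  shows "mat_wirtinger n m l (herm_chaos m d)
    (\<lambda>g i k. adj (chaos_part m d l g) i k + mat_cnj (chaos_part m d l g) i k)"
  unfolding mat_wirtinger_def
proof (intro allI impI)
  fix i k
  have "wirtinger m l (\<lambda>g. (\<Sum>j<m. d j * circ m g j i * circ m g j k)
        + (\<Sum>j<m. cnj (d j) * (cnj (circ m g j k) * cnj (circ m g j i))))
    (\<lambda>g. (\<Sum>j<m. d j * 0 * circ m g j k + d j * circ m g j i * 0) +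
      (\<Sum>j<m. cnj (d j) * ((if cidx m j k = l then 1 else 0) * cnj (circ m g j i)
          + cnj (circ m g j k) * (if cidx m j i = l then 1 else 0))))"
    by (intro wirtinger.add wirtinger_sum wirtinger_mult wirtinger_circ_id wirtinger_cmult
        wirtinger_cnj_circ_id) (use assms in auto)
  then show "wirtinger m l (\<lambda>g. herm_chaos m d g i k)
      (\<lambda>g. adj (chaos_part m d l g) i k + mat_cnj (chaos_part m d l g) i k)"
  proof (rule wirtinger_eq)
    fix g
    have "(\<Sum>j<m. cnj (d j) * ((if cidx m j k = l then 1 else 0) * cnj (circ m g j i)
          + cnj (circ m g j k) * (if cidx m j i = l then 1 else 0)))
       = (\<Sum>j<m. if cidx m j k = l then cnj (d j) * cnj (circ m g j i) else 0)
       + (\<Sum>j<m. if cidx m j i = l then cnj (d j) * cnj (circ m g j k) else 0)"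
      unfolding sum.distrib[symmetric] by (rule sum.cong) (auto simp: distrib_left)
    then show "adj (chaos_part m d l g) i k + mat_cnj (chaos_part m d l g) i k
      = (\<Sum>j<m. d j * 0 * circ m g j k + d j * circ m g j i * 0) +
      (\<Sum>j<m. cnj (d j) * ((if cidx m j k = l then 1 else 0) * cnj (circ m g j i)
          + cnj (circ m g j k) * (if cidx m j i = l then 1 else 0)))"
      by (simp add: sum_cidx_delta[OF assms] adj_def mat_cnj_def chaos_part_def)
  qed (simp add: herm_chaos_def chaos_def adj_def mult.assoc)
qed

section \<open>Family bounds and moments for the chaos\<close>

lemma family_bound_mono: "family_bound n L \<Theta> M \<Longrightarrow> \<Theta> \<le> \<Theta>' \<Longrightarrow> family_bound n L \<Theta>' M"
  unfolding family_bound_def by (meson mult_right_mono order_trans vnorm2_nonneg)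

lemma family_bound_cnj:
  assumes "family_bound n L \<Theta> M" shows "family_bound n L \<Theta> (\<lambda>l. mat_cnj (M l))"
  unfolding family_bound_def
proof
  fix x
  have "mat_vec n (mat_cnj A) x = (\<lambda>i. cnj (mat_vec n A (\<lambda>k. cnj (x k)) i))" for A
    by (simp add: mat_vec_def mat_cnj_def)
  then have "(\<Sum>l\<in>L. vnorm2 n (mat_vec n (mat_cnj (M l)) x))
      = (\<Sum>l\<in>L. vnorm2 n (mat_vec n (M l) (\<lambda>k. cnj (x k))))"
    by (simp only: vnorm2_def complex_mod_cnj)
  also have "\<dots> \<le> \<Theta> * vnorm2 n (\<lambda>k. cnj (x k))" using assms by (simp only: family_bound_def)
  also have "\<dots> = \<Theta> * vnorm2 n x" by (simp add: vnorm2_def)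
  finally show "(\<Sum>l\<in>L. vnorm2 n (mat_vec n (mat_cnj (M l)) x)) \<le> \<Theta> * vnorm2 n x" .
qed

text \<open>Row \<open>i\<close> is \<open>d\<close> times entry l + i of the circulant applied to
  \<open>x\<close>, and each entry is met by \<open>n\<close> pairs. Putting \<open>\<delta>\<close>
  into the Gram weight lets \<open>gram_moment\<close> apply with the same constants
  throughout.\<close>

lemma family_bound_chaos_part:
  assumes "0 < m" "0 < n" "0 < Q" and d: "\<And>j. j < m \<Longrightarrow> cmod (d j) \<le> \<delta>"
  shows "family_bound n {..<m} (real n * schatten n Q (gram m (\<lambda>j. of_real \<delta> * g j))) (\<lambda>l. chaos_part m d l g)"
  unfolding family_bound_def
proof
  fix x
  let ?f = "\<lambda>j. (cmod (circ_vec m n (\<lambda>j. of_real \<delta> * g j) x j))\<^sup>2"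
  have le: "(cmod (mat_vec n (chaos_part m d l g) x i))\<^sup>2 \<le> ?f ((l + i) mod m)" for l i
  proof -
    let ?j = "(l + i) mod m"
    have e1: "mat_vec n (chaos_part m d l g) x i = d ?j * circ_vec m n g x ?j"
      by (simp add: mat_vec_def chaos_part_def circ_vec_def sum_distrib_left mult.assoc)
    have e2: "circ_vec m n (\<lambda>j. of_real \<delta> * g j) x ?j = of_real \<delta> * circ_vec m n g x ?j"
      by (simp add: circ_vec_def circ_eq sum_distrib_left mult.assoc)
    have "cmod (d ?j) \<le> cmod (of_real \<delta>)" using d[of ?j] \<open>0 < m\<close> by simp
    then show ?thesis unfolding e1 e2 norm_mult by (intro power_mono mult_right_mono) auto
  qed
  have "(\<Sum>l<m. vnorm2 n (mat_vec n (chaos_part m d l g) x)) \<le> (\<Sum>l<m. \<Sum>i<n. ?f ((l + i) mod m))"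
    unfolding vnorm2_def by (intro sum_mono le)
  also have "\<dots> = real n * vnorm2 m (circ_vec m n (\<lambda>j. of_real \<delta> * g j) x)"
    by (subst sum_shift2[OF \<open>0 < m\<close>]) (simp add: vnorm2_def)
  also have "\<dots> \<le> real n * (schatten n Q (gram m (\<lambda>j. of_real \<delta> * g j)) * vnorm2 n x)"
    by (intro mult_left_mono vnorm2_circ_vec_le) (use assms in auto)
  finally show "(\<Sum>l<m. vnorm2 n (mat_vec n (chaos_part m d l g) x))
      \<le> real n * schatten n Q (gram m (\<lambda>j. of_real \<delta> * g j)) * vnorm2 n x" by (simp add: mult.assoc)
qed

text \<open>In the adjoint the coefficients \<open>d\<close> sit inside the sum over
  \<open>k\<close>. After a shift of \<open>l\<close> by \<open>i\<close>, row \<open>i\<close> is a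
  Hankel sum with weights \<open>d ((j + i) mod m)\<close>, so each row has its own weighted Gram
  matrix.\<close>

lemma family_bound_adj_chaos_part:
  assumes "0 < m" "0 < n" "0 < Q"
  shows "family_bound n {..<m} (\<Sum>i<n. schatten n Q (gram m (\<lambda>j. d ((j + i) mod m) * g j)))
     (\<lambda>l. adj (chaos_part m d l g))"
  unfolding family_bound_def
proof
  fix x
  define h where "h i j = d ((j + i) mod m) * g j" for i j
  let ?y = "\<lambda>i. schatten n Q (gram m (h i))"
  let ?f = "\<lambda>l i. (cmod (mat_vec n (adj (chaos_part m d l g)) x i))\<^sup>2"
  have i: "(\<Sum>l<m. ?f l i) \<le> ?y i * vnorm2 n (\<lambda>k. cnj (x k))" for i
  proof -
    have "mat_vec n (adj (chaos_part m d ((l + i) mod m) g)) x i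
        = cnj (\<Sum>k<n. h i ((l + k) mod m) * cnj (x k))" for l
    proof -
      have e: "((l + i) mod m + k) mod m = ((l + k) + i) mod m" for k
        unfolding mod_add_left_eq by (simp add: ac_simps)
      have e': "((l + k) mod m + i) mod m = ((l + k) + i) mod m" for k
        by (rule mod_add_left_eq)
      have "circ m g (((l + k) + i) mod m) i = g ((l + k) mod m)" for k
        by (rule circ_shift[OF \<open>0 < m\<close>])
      then show ?thesis
        by (simp only: mat_vec_def adj_def chaos_part_def h_def e e' cnj_sum complex_cnj_mult complex_cnj_cnj)
    qed
    then have "(\<Sum>l<m. ?f ((l + i) mod m) i) = (\<Sum>l<m. (cmod (\<Sum>k<n. h i ((l + k) mod m) * cnj (x k)))\<^sup>2)"
      by (simp only: complex_mod_cnj)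
    also have "\<dots> \<le> ?y i * vnorm2 n (\<lambda>k. cnj (x k))"
      by (rule vnorm2_hankel_le) fact+
    finally show ?thesis using sum_shift[OF \<open>0 < m\<close>, of "\<lambda>l. ?f l i" i] by simp
  qed
  have "(\<Sum>l<m. vnorm2 n (mat_vec n (adj (chaos_part m d l g)) x)) = (\<Sum>i<n. \<Sum>l<m. ?f l i)"
    unfolding vnorm2_def by (rule sum.swap)
  also have "\<dots> \<le> (\<Sum>i<n. ?y i * vnorm2 n (\<lambda>k. cnj (x k)))" by (intro sum_mono i)
  also have "\<dots> = (\<Sum>i<n. ?y i) * vnorm2 n x" by (simp add: vnorm2_def sum_distrib_right)
  finally show "(\<Sum>l<m. vnorm2 n (mat_vec n (adj (chaos_part m d l g)) x))
     \<le> (\<Sum>i<n. schatten n Q (gram m (\<lambda>j. d ((j + i) mod m) * g j))) * vnorm2 n x"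
    by (simp add: h_def[abs_def])
qed

lemma mat_mult_add_left:
  "mat_mult n (\<lambda>i j. A i j + B i j) C = (\<lambda>i j. mat_mult n A C i j + mat_mult n B C i j)"
  by (intro ext) (simp add: mat_mult_def distrib_right sum.distrib)

text \<open>Now \<open>\<Theta>\<close> is a sum of 2n Gram norms y, and the words leave terms y
  z^(2N) with z the norm of the chaos. Young's inequality separates them: the power z^(2N+2) is
  absorbed, the Gram part is known from \<open>gram_moment\<close>.\<close>

lemma herm_chaos_moment:
  assumes s2: "0 < s2" and n: "0 < n" "n \<le> m" "real n \<le> 3 ^ Suc N"
    and \<delta>0: "0 < \<delta>" and d: "\<And>j. j < m \<Longrightarrow> cmod (d j) \<le> \<delta>"
    and \<Lambda>: "\<Lambda> = 6 * s2 * \<delta>\<^sup>2 * (real m + 2 * real (Suc N) * real n)"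
    and L: "L = 96 * s2 * real (Suc N) * real n"
  shows "integrable (cgauss_vec s2 m) (\<lambda>g. frob2 n (mat_pow n (herm_chaos m d g) (Suc N)))"
    and "(\<integral>g. frob2 n (mat_pow n (herm_chaos m d g) (Suc N)) \<partial>cgauss_vec s2 m) \<le> 2 * (L * \<Lambda>) ^ Suc N"
proof -
  have m: "0 < m" using n by simp
  let ?M = "cgauss_vec s2 m"
  interpret prob_space ?M by (rule prob_space_cgauss_vec[OF s2])
  define H where "H g = herm_chaos m d g" for g
  define P where "P l g = chaos_part m d l g" for l g
  define z where "z g = schatten n (Suc N) (H g)" for g
  define F where "F g = frob2 n (mat_pow n (H g) (Suc N))" for g
  define G where "G \<beta> g = gram m (\<lambda>j. \<beta> j * g j)" for \<beta> g :: "nat \<Rightarrow> complex"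
  define y where "y \<beta> g = schatten n (Suc N) (G \<beta> g)" for \<beta> g
  define e where "e \<beta> g = frob2 n (mat_pow n (G \<beta> g) (Suc N))" for \<beta> g
  \<comment> \<open>Weights for the rows of the adjoint family; \<open>\<gamma>\<close> below is the
    constant weight for the family itself.\<close>
  define \<beta> where "\<beta> i j = d ((j + i) mod m)" for i j
  define \<gamma> where "\<gamma> (j::nat) = complex_of_real \<delta>" for j
  define D where "D l g = tr n (mat_mult n (\<lambda>i k. 0) (mat_pow n (H g) (2 * N + 1)))
      + (\<Sum>c<2 * N + 1. tr n (mat_mult n (P l g) (mat_mult n (mat_pow n (H g) c)
            (mat_mult n (\<lambda>i k. adj (P l g) i k + mat_cnj (P l g) i k) (mat_pow n (H g) (2 * N + 1 - Suc c))))))" for l g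
  have H: "adj (H g) = H g" for g by (simp add: H_def adj_herm_chaos)
  have z: "0 \<le> z g" "z g ^ (2 * Suc N) = F g" for g
    unfolding z_def F_def by (rule schatten_nonneg, rule schatten_power) simp
  have y: "0 \<le> y b g" "y b g ^ (2 * Suc N) = e b g" for b g
    unfolding y_def e_def by (rule schatten_nonneg, rule schatten_power) simp
  have \<Lambda>0: "0 < \<Lambda>" unfolding \<Lambda> using s2 \<delta>0 m by (intro mult_pos_pos add_pos_nonneg) auto
  have L0: "0 < L" unfolding L using s2 n by simp
  have e: "integrable ?M (e b)" "(\<integral>g. e b g \<partial>?M) \<le> \<Lambda> ^ (2 * Suc N)" if "\<And>j. j < m \<Longrightarrow> cmod (b j) \<le> \<delta>" for b
    unfolding e_def[abs_def] G_def[abs_def]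
    using gram_moment[where \<beta> = b, OF s2 n \<delta>0 _ \<Lambda>] that by blast+
  have \<beta>: "cmod (\<beta> i j) \<le> \<delta>" and \<gamma>: "cmod (\<gamma> j) \<le> \<delta>" for i j
    using d m \<delta>0 by (auto simp: \<beta>_def \<gamma>_def)
  note e\<beta> = e[OF \<beta>] and e\<gamma> = e[OF \<gamma>]
  have ibp: "integrable ?M (\<lambda>g. g l * tr n (mat_mult n (P l g) (mat_pow n (H g) (2 * N + 1))))"
    "integrable ?M (D l)"
    "(\<integral>g. g l * tr n (mat_mult n (P l g) (mat_pow n (H g) (2 * N + 1))) \<partial>?M)
      = of_real s2 * (\<integral>g. D l g \<partial>?M)" if "l < m" for l
    unfolding P_def H_def D_def
    by (rule trace_integration_by_parts[OF s2 that mat_wirtinger_chaos_part[OF m]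
          mat_wirtinger_herm_chaos[OF m that]])+
  define S where "S g = (\<Sum>l<m. g l * tr n (mat_mult n (P l g) (mat_pow n (H g) (2 * N + 1))))" for g
  \<comment> \<open>The adjoint half of \<open>herm_chaos\<close> contributes the complex conjugate,
    so only the half without conjugates is expanded.\<close>
  have F_eq: "F g = 2 * Re (S g)" for g
  proof -
    let ?A = "chaos m d g" and ?Y = "mat_pow n (H g) (2 * N + 1)"
    have "complex_of_real (F g) = tr n (mat_mult n (H g) ?Y)"
      using tr_pow_even[OF H, of n g "Suc N"] by (simp add: F_def)
    also have "\<dots> = tr n (mat_mult n ?A ?Y) + tr n (mat_mult n (adj ?A) ?Y)"
      unfolding H_def[of g] herm_chaos_def mat_mult_add_left tr_add ..
    also have "tr n (mat_mult n (adj ?A) ?Y) = cnj (tr n (mat_mult n ?A ?Y))"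
      unfolding tr_adj[symmetric] adj_mult adj_pow[OF H] by (rule tr_mult_commute)
    also have "tr n (mat_mult n ?A ?Y) = S g"
      unfolding S_def by (rule tr_mult_decompose) (simp add: P_def chaos_decompose[OF m])
    finally have "complex_of_real (F g) = S g + cnj (S g)" .
    then show ?thesis by (metis complex_add_cnj of_real_eq_iff)
  qed
  have int_S: "integrable ?M S"
    unfolding S_def by (intro Bochner_Integration.integrable_sum ibp) simp
  have int: "integrable ?M F"
    unfolding F_eq using int_S by (intro integrable_mult_right integrable_Re)
  define u where "u g = 24 * s2 * real (Suc N) * L ^ N * (\<Sum>i<n. 2 * \<Lambda> ^ Suc N + (e (\<beta> i) g + e \<gamma> g) / \<Lambda> ^ Suc N)" for g
  have bound: "cmod (2 * of_real s2 * (\<Sum>l<m. D l g)) \<le> F g / 2 + u g" for g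
  proof -
    let ?T = "\<Sum>i<n. y (\<beta> i) g + y \<gamma> g"
    have T0: "0 \<le> ?T" using y by (intro sum_nonneg add_nonneg_nonneg)
    have fb1: "family_bound n {..<m} ?T (\<lambda>l. P l g)"
    proof (rule family_bound_mono)
      show "family_bound n {..<m} (real n * y \<gamma> g) (\<lambda>l. P l g)"
        unfolding P_def y_def G_def \<gamma>_def by (rule family_bound_chaos_part; use m n d in simp)
      show "real n * y \<gamma> g \<le> ?T" using y(1) by (simp add: sum.distrib sum_nonneg)
    qed
    have fb2: "family_bound n {..<m} ?T (\<lambda>l. adj (P l g))"
    proof (rule family_bound_mono)
      show "family_bound n {..<m} (\<Sum>i<n. y (\<beta> i) g) (\<lambda>l. adj (P l g))"
        unfolding P_def y_def G_def \<beta>_def by (rule family_bound_adj_chaos_part) (use m n in auto)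
      show "(\<Sum>i<n. y (\<beta> i) g) \<le> ?T" using y(1) by (intro sum_mono) simp
    qed
    have fb3: "family_bound n {..<m} ?T (\<lambda>l. mat_cnj (P l g))" by (rule family_bound_cnj[OF fb1])
    have fb4: "family_bound n {..<m} ?T (\<lambda>l. adj (mat_cnj (P l g)))"
      using family_bound_cnj[OF fb2] by (simp add: mat_cnj_def adj_def)
    have DS: "(\<Sum>l<m. D l g) = (\<Sum>c<2 * N + 1.
       (\<Sum>l<m. tr n (mat_mult n (P l g) (mat_mult n (mat_pow n (H g) c)
            (mat_mult n (adj (P l g)) (mat_pow n (H g) (2 * N + 1 - Suc c)))))) +
       (\<Sum>l<m. tr n (mat_mult n (P l g) (mat_mult n (mat_pow n (H g) c)
            (mat_mult n (mat_cnj (P l g)) (mat_pow n (H g) (2 * N + 1 - Suc c)))))))"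
    proof -
      \<comment> \<open>The coefficient has derivative zero, so unlike for the Gram matrix only
        words remain.\<close>
      have Z: "tr n (mat_mult n (\<lambda>i k. 0) (mat_pow n (H g) (2 * N + 1))) = 0"
        by (simp add: tr_def mat_mult_def)
      show ?thesis
        unfolding D_def mat_mult_add_left mat_mult_add_right tr_add Z add_0_left sum.distrib[symmetric]
        by (rule sum.swap)
    qed
    \<comment> \<open>Two words for each of the 2N + 1 positions; the 3 is the cost of lowering the
      exponent.\<close>
    have "cmod (\<Sum>l<m. D l g) \<le> (\<Sum>c<2 * N + 1. ?T * (3 * z g ^ (2 * N)) + ?T * (3 * z g ^ (2 * N)))"
      unfolding DS
    proof (intro sum_norm_le norm_triangle_le add_mono)
      fix c assume c: "c \<in> {..<2 * N + 1}"
      have le: "?T * frob2 n (mat_pow n (H g) N) \<le> ?T * (3 * z g ^ (2 * N))"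
        by (rule mult_left_mono[OF _ T0]) (unfold z_def, rule frob2_pow_pred_le[OF H n(3)])
      show "cmod (\<Sum>l<m. tr n (mat_mult n (P l g) (mat_mult n (mat_pow n (H g) c)
            (mat_mult n (adj (P l g)) (mat_pow n (H g) (2 * N + 1 - Suc c)))))) \<le> ?T * (3 * z g ^ (2 * N))"
        by (rule order_trans[OF family_bound_tr_le[OF H finite_lessThan T0 fb1 fb2 fb2] le])
          (use c in \<open>simp_all add: fb1\<close>)
      show "cmod (\<Sum>l<m. tr n (mat_mult n (P l g) (mat_mult n (mat_pow n (H g) c)
            (mat_mult n (mat_cnj (P l g)) (mat_pow n (H g) (2 * N + 1 - Suc c)))))) \<le> ?T * (3 * z g ^ (2 * N))"
        by (rule order_trans[OF family_bound_tr_le[OF H finite_lessThan T0 fb1 fb2 fb3 fb4] le])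
          (use c in simp)
    qed
    also have "\<dots> = 6 * real (2 * N + 1) * (?T * z g ^ (2 * N))"
      by simp
    also have "\<dots> \<le> 6 * (2 * real (Suc N)) * (?T * z g ^ (2 * N))"
      by (intro mult_right_mono mult_nonneg_nonneg T0) (use z in auto)
    finally have "cmod (2 * of_real s2 * (\<Sum>l<m. D l g)) \<le> 2 * s2 * (6 * (2 * real (Suc N)) * (?T * z g ^ (2 * N)))"
      unfolding norm_mult using s2 by (simp add: mult_left_mono)
    also have "\<dots> = 24 * s2 * real (Suc N) * (?T * z g ^ (2 * N))" by simp
    also have "\<dots> \<le> 24 * s2 * real (Suc N) *
        (\<Sum>i<n. L ^ N * (2 * \<Lambda> ^ Suc N + (e (\<beta> i) g + e \<gamma> g) / \<Lambda> ^ Suc N) + 2 * F g / L)"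
    proof (rule mult_left_mono)
      \<comment> \<open>First y (z^2)^N is split with weight \<open>L\<close>; then y^(N+1) is
        bounded through its square, whose mean \<open>gram_moment\<close> controls.\<close>
      have one: "y b g * z g ^ (2 * N) \<le> L ^ N * (\<Lambda> ^ Suc N + e b g / \<Lambda> ^ Suc N) + F g / L" for b
      proof -
        have "y b g * (z g ^ 2) ^ N \<le> L ^ N * y b g ^ Suc N + (z g ^ 2) ^ Suc N / L"
          by (intro mult_power_le_split y L0) simp
        moreover have "1 * (y b g ^ Suc N) ^ 1 \<le> (\<Lambda> ^ Suc N) ^ 1 * 1 ^ Suc 1 + (y b g ^ Suc N) ^ Suc 1 / \<Lambda> ^ Suc N"
          by (rule mult_power_le_split) (use y \<Lambda>0 in auto)
        then have "y b g ^ Suc N \<le> \<Lambda> ^ Suc N + e b g / \<Lambda> ^ Suc N"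
          unfolding y(2)[symmetric] by (simp add: power_mult power2_eq_square power_mult_distrib mult_ac)
        then have "L ^ N * y b g ^ Suc N \<le> L ^ N * (\<Lambda> ^ Suc N + e b g / \<Lambda> ^ Suc N)"
          using L0 by (intro mult_left_mono) auto
        ultimately show ?thesis unfolding z(2)[symmetric] by (simp only: power_mult)
      qed
      have "?T * z g ^ (2 * N) = (\<Sum>i<n. y (\<beta> i) g * z g ^ (2 * N) + y \<gamma> g * z g ^ (2 * N))"
        by (simp add: sum_distrib_right distrib_right)
      also have "\<dots> \<le> (\<Sum>i<n. L ^ N * (2 * \<Lambda> ^ Suc N + (e (\<beta> i) g + e \<gamma> g) / \<Lambda> ^ Suc N) + 2 * F g / L)"
      proof (rule sum_mono)
        fix i
        show "y (\<beta> i) g * z g ^ (2 * N) + y \<gamma> g * z g ^ (2 * N)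
          \<le> L ^ N * (2 * \<Lambda> ^ Suc N + (e (\<beta> i) g + e \<gamma> g) / \<Lambda> ^ Suc N) + 2 * F g / L"
          using add_mono[OF one[of "\<beta> i"] one[of \<gamma>]] by (simp add: algebra_simps add_divide_distrib)
      qed
      finally show "?T * z g ^ (2 * N) \<le> (\<Sum>i<n. L ^ N * (2 * \<Lambda> ^ Suc N + (e (\<beta> i) g + e \<gamma> g) / \<Lambda> ^ Suc N) + 2 * F g / L)" .
    qed (use s2 in auto)
    also have "\<dots> = u g + 24 * s2 * real (Suc N) * (real n * (2 * F g / L))"
      unfolding u_def sum.distrib distrib_left by (simp add: sum_distrib_left mult.assoc)
    \<comment> \<open>\<open>L\<close> is chosen for this: 24 * 2 / 96 is one half.\<close>
    also have "24 * s2 * real (Suc N) * (real n * (2 * F g / L)) = F g / 2"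
      unfolding L using s2 n by (simp add: divide_simps)
    finally show ?thesis by simp
  qed
  have int_u: "integrable ?M u" unfolding u_def
    by (intro integrable_mult_right Bochner_Integration.integrable_sum Bochner_Integration.integrable_add
        integrable_divide e\<beta> e\<gamma>) simp
  have "(\<integral>g. F g \<partial>?M) \<le> 2 * (\<integral>g. u g \<partial>?M)"
  proof (rule integral_le_of_self_bound[OF int int_u _ _ bound])
    show "integrable ?M (\<lambda>g. 2 * of_real s2 * (\<Sum>l<m. D l g))"
      by (intro integrable_mult_right Bochner_Integration.integrable_sum ibp) simp
    have "(\<integral>g. S g \<partial>?M) = (\<Sum>l<m. \<integral>g. g l * tr n (mat_mult n (P l g) (mat_pow n (H g) (2 * N + 1))) \<partial>?M)"
      unfolding S_def by (rule Bochner_Integration.integral_sum, rule ibp(1), simp)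
    also have "\<dots> = (\<Sum>l<m. of_real s2 * (\<integral>g. D l g \<partial>?M))"
      by (rule sum.cong[OF refl], rule ibp(3), simp)
    also have "2 * \<dots> = (\<integral>g. 2 * of_real s2 * (\<Sum>l<m. D l g) \<partial>?M)"
      by (simp add: ibp sum_distrib_left mult.assoc)
    finally have "2 * (\<integral>g. S g \<partial>?M) = (\<integral>g. 2 * of_real s2 * (\<Sum>l<m. D l g) \<partial>?M)" by simp
    moreover have "(\<integral>g. F g \<partial>?M) = Re (2 * (\<integral>g. S g \<partial>?M))"
      unfolding F_eq using int_S by simp
    ultimately show "(\<integral>g. F g \<partial>?M) = Re (\<integral>g. 2 * of_real s2 * (\<Sum>l<m. D l g) \<partial>?M)" by simp
  qed
  also have "(\<integral>g. u g \<partial>?M) = 24 * s2 * real (Suc N) * L ^ N *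
      (\<Sum>i<n. 2 * \<Lambda> ^ Suc N + ((\<integral>g. e (\<beta> i) g \<partial>?M) + (\<integral>g. e \<gamma> g \<partial>?M)) / \<Lambda> ^ Suc N)"
    unfolding u_def using e\<beta>(1) e\<gamma>(1) prob_space by simp
  also have "\<dots> \<le> 24 * s2 * real (Suc N) * L ^ N * (\<Sum>i<n. 2 * \<Lambda> ^ Suc N + (\<Lambda> ^ (2 * Suc N) + \<Lambda> ^ (2 * Suc N)) / \<Lambda> ^ Suc N)"
    by (intro mult_left_mono sum_mono add_left_mono divide_right_mono add_mono e\<beta> e\<gamma>)
      (use s2 L0 \<Lambda>0 in auto)
  also have "(\<Lambda> ^ (2 * Suc N) + \<Lambda> ^ (2 * Suc N)) / \<Lambda> ^ Suc N = 2 * \<Lambda> ^ Suc N"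
  proof -
    have "\<Lambda> ^ (2 * Suc N) = \<Lambda> ^ Suc N * \<Lambda> ^ Suc N" by (simp only: power_add[symmetric] mult_2)
    then show ?thesis using \<Lambda>0 by (simp add: field_simps)
  qed
  \<comment> \<open>The sum equals 4 n \<open>\<Lambda> ^ Suc N\<close>, and 24 * 4 = 96 supplies
    the missing factor \<open>L\<close>.\<close>
  also have "24 * s2 * real (Suc N) * L ^ N * (\<Sum>i<n. 2 * \<Lambda> ^ Suc N + 2 * \<Lambda> ^ Suc N) = (L * \<Lambda>) ^ Suc N"
    unfolding power_mult_distrib power_Suc[of L] by (subst (2) L) simp
  finally show "(\<integral>g. frob2 n (mat_pow n (herm_chaos m d g) (Suc N)) \<partial>?M) \<le> 2 * (L * \<Lambda>) ^ Suc N"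
    by (simp only: F_def H_def mult_left_mono)
  show "integrable ?M (\<lambda>g. frob2 n (mat_pow n (herm_chaos m d g) (Suc N)))"
    using int by (simp only: F_def[abs_def] H_def)
qed

section \<open>The moment bound\<close>

text \<open>Cartesian decomposition: replacing \<open>d\<close> by i d multiplies the chaos by i, so
  the second term supplies the skew-Hermitian half.\<close>

lemma chaos_eq_herm_chaos:
  "2 * chaos m d g i k = herm_chaos m d g i k - \<i> * herm_chaos m (\<lambda>j. \<i> * d j) g i k"
proof -
  have "chaos m (\<lambda>j. \<i> * d j) g i k = \<i> * chaos m d g i k" for i k
    by (simp add: chaos_def sum_distrib_left mult.assoc)
  then show ?thesis by (simp add: herm_chaos_def adj_def algebra_simps)
qed

lemma quad_form_eq_chaos:
  "quad_form m n b g w / of_nat m = (\<Sum>i<n. w i * mat_vec n (chaos m (\<lambda>j. b j / of_nat m) g) w i)"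
proof -
  have e: "(\<Sum>j<m. circ m g j i * b j * (\<Sum>k<n. circ m g j k * w k)) / of_nat m
      = mat_vec n (chaos m (\<lambda>j. b j / of_nat m) g) w i" for i
  proof -
    have "(\<Sum>j<m. circ m g j i * b j * (\<Sum>k<n. circ m g j k * w k)) / of_nat m
       = (\<Sum>j<m. \<Sum>k<n. b j / of_nat m * circ m g j i * circ m g j k * w k)"
      by (simp add: sum_divide_distrib sum_distrib_left mult_ac)
    also have "\<dots> = mat_vec n (chaos m (\<lambda>j. b j / of_nat m) g) w i"
      by (subst sum.swap) (simp add: mat_vec_def chaos_def sum_distrib_right)
    finally show ?thesis .
  qed
  show ?thesis unfolding quad_form_def e[symmetric]
    by (subst sum_divide_distrib) simp
qed

lemma csphere_nonempty:
  assumes n: "0 < n" shows "csphere n \<noteq> {}"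
proof -
  have "(\<Sum>i<n. (cmod (if i = 0 then 1 else 0))\<^sup>2) = (\<Sum>i<n. if i = 0 then 1 else 0)"
    by (rule sum.cong) auto
  then have "(\<lambda>i. if i = 0 then 1 else 0) \<in> csphere n" using n by (simp add: csphere_def)
  then show ?thesis by blast
qed

lemma Nsup_le_schatten:
  fixes m :: nat and b :: "nat \<Rightarrow> complex"
  assumes "0 < n" "0 < Q"
  defines "d \<equiv> \<lambda>j. b j / of_nat m"
  shows "Nsup m n b g \<le> (schatten n Q (herm_chaos m d g) + schatten n Q (herm_chaos m (\<lambda>j. \<i> * d j) g)) / 2"
  unfolding Nsup_def
proof (rule cSUP_least[OF csphere_nonempty[OF assms(1)]])
  fix w assume "w \<in> csphere n"
  then have w: "vnorm2 n w = 1" by (simp add: csphere_def vnorm2_def)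
  let ?H = "\<lambda>d. herm_chaos m d g" and ?d = "\<lambda>j. \<i> * d j"
  have le: "cmod (\<Sum>i<n. w i * mat_vec n (?H d) w i) \<le> schatten n Q (?H d)" for d
    using form_le_schatten[OF adj_herm_chaos \<open>0 < Q\<close>, where y = w and x = w and n = n] by (simp add: w)
  have "2 * mat_vec n (chaos m d g) w i = mat_vec n (?H d) w i - \<i> * mat_vec n (?H ?d) w i" for i
  proof -
    have "2 * mat_vec n (chaos m d g) w i = (\<Sum>k<n. 2 * chaos m d g i k * w k)"
      by (simp add: mat_vec_def sum_distrib_left mult.assoc)
    then show ?thesis
      unfolding chaos_eq_herm_chaos
      by (simp add: mat_vec_def sum_distrib_left sum_subtractf left_diff_distrib mult.assoc)
  qed
  then have "2 * (quad_form m n b g w / of_nat m)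
      = (\<Sum>i<n. w i * (mat_vec n (?H d) w i - \<i> * mat_vec n (?H ?d) w i))"
    unfolding quad_form_eq_chaos d_def[symmetric] sum_distrib_left
    by (simp only: mult.left_commute[of 2])
  also have "\<dots> = (\<Sum>i<n. w i * mat_vec n (?H d) w i) - \<i> * (\<Sum>i<n. w i * mat_vec n (?H ?d) w i)"
    by (simp add: right_diff_distrib sum_subtractf sum_distrib_left mult.left_commute)
  finally have "cmod (2 * (quad_form m n b g w / of_nat m))
      \<le> cmod (\<Sum>i<n. w i * mat_vec n (?H d) w i) + cmod (\<i> * (\<Sum>i<n. w i * mat_vec n (?H ?d) w i))"
    by (metis norm_triangle_ineq4)
  then have "2 * cmod (quad_form m n b g w / of_nat m) \<le> schatten n Q (?H d) + schatten n Q (?H ?d)"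
    using le[of d] le[of ?d] unfolding norm_mult by simp
  then show "cmod (quad_form m n b g w / of_nat m) \<le> (schatten n Q (?H d) + schatten n Q (?H ?d)) / 2"
    by simp
qed

text \<open>A real supremum dominates its members only over a bounded set; the Frobenius norm gives
  the bound.\<close>

lemma Nsup_nonneg:
  assumes "0 < n" shows "0 \<le> Nsup m n b g"
proof -
  obtain w where w: "w \<in> csphere n" using csphere_nonempty[OF assms] by blast
  let ?d = "\<lambda>j. b j / of_nat m"
  have "bdd_above ((\<lambda>w. cmod (quad_form m n b g w / of_nat m)) ` csphere n)"
  proof (rule bdd_aboveI2)
    fix w assume "w \<in> csphere n"
    then have w: "vnorm2 n w = 1" by (simp add: csphere_def vnorm2_def)
    have "(cmod (quad_form m n b g w / of_nat m))\<^sup>2 \<le> vnorm2 n w * vnorm2 n (mat_vec n (chaos m ?d g) w)"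
      unfolding quad_form_eq_chaos vnorm2_def by (rule Cauchy_Schwarz_complex_sum)
    also have "\<dots> \<le> frob2 n (chaos m ?d g)"
      using vnorm2_mat_vec_le[of n "chaos m ?d g" w] by (simp add: w)
    finally show "cmod (quad_form m n b g w / of_nat m) \<le> sqrt (frob2 n (chaos m ?d g))"
      by (rule real_le_rsqrt)
  qed
  then show ?thesis unfolding Nsup_def
    by (rule order_trans[OF norm_ge_zero cSUP_upper[OF w]])
qed

section \<open>From trace moments to L^p norms\<close>

text \<open>Truncation at the scale \<open>R\<close>: below it the power is at most
  \<open>R ^ p\<close>; above it the surplus factor (z/R)^(q-p) is at least 1.\<close>

lemma power_le_of_moment:
  fixes v z1 z2 R :: real
  assumes "0 \<le> v" "0 \<le> z1" "0 \<le> z2" "v \<le> (z1 + z2) / 2" "0 < R" "p \<le> q"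
  shows "v ^ p \<le> R ^ p + (z1 ^ q + z2 ^ q) / R ^ (q - p)"
proof -
  define z where "z = max z1 z2"
  have z: "v \<le> z" "0 \<le> z" using assms by (auto simp: z_def)
  have zq: "z ^ q \<le> z1 ^ q + z2 ^ q" using assms by (auto simp: z_def max_def)
  have "v ^ p \<le> z ^ p" using z assms by (intro power_mono)
  also have "\<dots> \<le> R ^ p + z ^ q / R ^ (q - p)"
  proof (cases "z \<le> R")
    case True
    then have "z ^ p \<le> R ^ p" using z by (intro power_mono)
    then show ?thesis using z assms by (simp add: add_increasing2)
  next
    case False
    have "z ^ p * R ^ (q - p) \<le> z ^ p * z ^ (q - p)"
      using False z assms by (intro mult_left_mono power_mono) auto
    also have "\<dots> = z ^ q" using assms by (simp add: power_add[symmetric])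
    finally have "z ^ p \<le> z ^ q / R ^ (q - p)" using assms by (simp add: field_simps)
    then show ?thesis using assms by (simp add: add_increasing)
  qed
  also have "\<dots> \<le> R ^ p + (z1 ^ q + z2 ^ q) / R ^ (q - p)"
    using zq assms by (intro add_left_mono divide_right_mono) auto
  finally show ?thesis .
qed

lemma lp_norm_le:
  assumes "1 \<le> p" "0 \<le> R" and le: "(\<integral>\<^sup>+x. ennreal (\<bar>X x\<bar> ^ p) \<partial>M) \<le> ennreal (R ^ p)"
  shows "lp_norm M p X \<le> ennreal R"
proof -
  let ?I = "\<integral>\<^sup>+x. ennreal (\<bar>X x\<bar> ^ p) \<partial>M"
  have "?I < \<infinity>" using le by (rule order.strict_trans1) simp
  then have fin: "?I \<noteq> \<infinity>" by simp
  have "enn2real ?I \<le> R ^ p" using le assms by (simp add: enn2real_leI)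
  then have "enn2real ?I powr (1 / real p) \<le> (R ^ p) powr (1 / real p)"
    by (intro powr_mono2) auto
  also have "\<dots> = R"
  proof (cases "R = 0")
    case True then show ?thesis using assms by (simp add: power_0_left)
  next
    case False
    then have "0 < R" using assms by simp
    then show ?thesis using assms by (simp add: powr_realpow[symmetric] powr_powr)
  qed
  finally show ?thesis using fin by (simp add: lp_norm_def Let_def ennreal_leI)
qed

text \<open>Moments of order 2Q of the two Hermitian matrices are converted to order
  \<open>p\<close> at the scale R with R^2 = L \<open>\<Lambda>\<close>.\<close>

lemma lp_norm_Nsup_le:
  assumes s2: "0 < s2" and n: "0 < n" "n \<le> m" "real n \<le> 3 ^ Q" and p: "1 \<le> p" "p \<le> 2 * Q"
  shows "lp_norm (cgauss_vec s2 m) p (Nsup m n b)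
    \<le> ennreal (120 * s2 * sup_norm m b / real m * sqrt (real Q * real n * (real m + 2 * real Q * real n)))"
proof -
  let ?M = "cgauss_vec s2 m"
  interpret prob_space ?M by (rule prob_space_cgauss_vec[OF s2])
  have m: "0 < m" using n by simp
  obtain N where N: "Q = Suc N" using p by (cases Q) auto
  define \<delta> where "\<delta> = sup_norm m b / real m"
  define d where "d j = b j / of_nat m" for j
  have b: "cmod (b j) \<le> sup_norm m b" if "j < m" for j
    unfolding sup_norm_def using that by (intro Max_ge) auto
  then have d: "cmod (d j) \<le> \<delta>" if "j < m" for j
    using that by (simp add: d_def \<delta>_def norm_divide divide_right_mono)
  have \<delta>: "0 \<le> \<delta>" using d[OF m] norm_ge_zero order_trans by blast
  show ?thesis
  \<comment> \<open>The moment bounds require a positive scale; at zero all relevant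
    \<open>b j\<close>, and with them the supremum, vanish.\<close>
  proof (cases "\<delta> = 0")
    case True
    then have "b j = 0" if "j < m" for j using d[OF that] m by (simp add: d_def)
    then have "Nsup m n b g = 0" for g
      using csphere_nonempty[OF n(1)] by (simp add: Nsup_def quad_form_def)
    then have "lp_norm ?M p (Nsup m n b) \<le> ennreal 0" using p by (intro lp_norm_le) (auto simp: power_0_left)
    then show ?thesis by simp
  next
    case False
    then have \<delta>0: "0 < \<delta>" using \<delta> by simp
    define \<Lambda> where "\<Lambda> = 6 * s2 * \<delta>\<^sup>2 * (real m + 2 * real (Suc N) * real n)"
    define L where "L = 96 * s2 * real (Suc N) * real n"
    define R where "R = sqrt (L * \<Lambda>)"
    have L\<Lambda>: "0 < L * \<Lambda>" unfolding L_def \<Lambda>_def using s2 \<delta>0 m n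
      by (intro mult_pos_pos add_pos_nonneg) auto
    then have R0: "0 < R" by (simp add: R_def)
    have R2: "R ^ (2 * Q) = (L * \<Lambda>) ^ Suc N" using L\<Lambda> by (simp only: R_def power_mult N) simp
    have d': "cmod (\<i> * d j) \<le> \<delta>" if "j < m" for j using d[OF that] by (simp add: norm_mult)
    define f where "f d g = frob2 n (mat_pow n (herm_chaos m d g) Q)" for d g
    note mom = herm_chaos_moment[OF s2 n(1,2) n(3)[unfolded N] \<delta>0 _ \<Lambda>_def L_def, folded N]
    have i: "integrable ?M (f d)" "integrable ?M (f (\<lambda>j. \<i> * d j))"
      "(\<integral>g. f d g \<partial>?M) \<le> 2 * R ^ (2 * Q)" "(\<integral>g. f (\<lambda>j. \<i> * d j) g \<partial>?M) \<le> 2 * R ^ (2 * Q)"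
      unfolding f_def[abs_def] using mom[of d] mom[of "\<lambda>j. \<i> * d j"] d d' R2 by (auto simp: N)
    let ?u = "\<lambda>g. R ^ p + (f d g + f (\<lambda>j. \<i> * d j) g) / R ^ (2 * Q - p)"
    have le: "\<bar>Nsup m n b g\<bar> ^ p \<le> ?u g" for g
    proof -
      have Q: "0 < Q" by (simp add: N)
      show ?thesis unfolding f_def schatten_power[OF Q, symmetric]
        using Nsup_nonneg[OF n(1)] Nsup_le_schatten[OF n(1) Q, of m b g] R0 p
        by (intro power_le_of_moment) (auto simp: d_def[abs_def])
    qed
    have u0: "0 \<le> ?u g" for g by (rule order_trans[OF _ le]) simp
    have iu: "integrable ?M ?u" using i by simp
    have "(\<integral>\<^sup>+g. ennreal (\<bar>Nsup m n b g\<bar> ^ p) \<partial>?M) \<le> (\<integral>\<^sup>+g. ennreal (?u g) \<partial>?M)"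
      by (intro nn_integral_mono ennreal_leI le)
    also have "\<dots> = ennreal (\<integral>g. ?u g \<partial>?M)"
      by (rule nn_integral_eq_integral[OF iu]) (simp only: u0 AE_I2)
    also have "(\<integral>g. ?u g \<partial>?M) = R ^ p + ((\<integral>g. f d g \<partial>?M) + (\<integral>g. f (\<lambda>j. \<i> * d j) g \<partial>?M)) / R ^ (2 * Q - p)"
      using i prob_space by simp
    also have "ennreal \<dots> \<le> ennreal ((5 * R) ^ p)"
    proof (rule ennreal_leI)
      \<comment> \<open>Each of the two matrices contributes at most 2 R^p, in total 5 R^p, and 5
        \<le> 5^p.\<close>
      have "R ^ (2 * Q) / R ^ (2 * Q - p) = R ^ p"
        using R0 p by (simp add: power_diff)
      then have "(2 * R ^ (2 * Q) + 2 * R ^ (2 * Q)) / R ^ (2 * Q - p) = 4 * R ^ p"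
        by (simp add: add_divide_distrib[symmetric])
      moreover have "((\<integral>g. f d g \<partial>?M) + (\<integral>g. f (\<lambda>j. \<i> * d j) g \<partial>?M)) / R ^ (2 * Q - p)
          \<le> (2 * R ^ (2 * Q) + 2 * R ^ (2 * Q)) / R ^ (2 * Q - p)"
        using i R0 by (intro divide_right_mono add_mono) auto
      ultimately have "R ^ p + ((\<integral>g. f d g \<partial>?M) + (\<integral>g. f (\<lambda>j. \<i> * d j) g \<partial>?M)) / R ^ (2 * Q - p) \<le> 5 * R ^ p"
        by linarith
      also have "5 * R ^ p \<le> 5 ^ p * R ^ p"
        using p R0 power_increasing[of 1 p "5::real"] by (intro mult_right_mono) auto
      finally show "R ^ p + ((\<integral>g. f d g \<partial>?M) + (\<integral>g. f (\<lambda>j. \<i> * d j) g \<partial>?M)) / R ^ (2 * Q - p) \<le> (5 * R) ^ p"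
        by (simp add: power_mult_distrib)
    qed
    finally have "lp_norm ?M p (Nsup m n b) \<le> ennreal (5 * R)"
      using R0 p by (intro lp_norm_le) auto
    also have "R = 24 * s2 * \<delta> * sqrt (real Q * real n * (real m + 2 * real Q * real n))"
    proof -
      \<comment> \<open>Here 96 * 6 = 24^2; the factor 5 then yields 120.\<close>
      have "L * \<Lambda> = (24 * s2 * \<delta>)\<^sup>2 * (real Q * real n * (real m + 2 * real Q * real n))"
        unfolding L_def \<Lambda>_def N power2_eq_square by simp
      then show ?thesis unfolding R_def using s2 \<delta> by (simp add: real_sqrt_mult)
    qed
    finally show ?thesis by (simp add: \<delta>_def mult.assoc)
  qed
qed

section \<open>Simplifying the numerical bound\<close>

text \<open>At \<open>n = 1\<close> the logarithm is zero; otherwise it is at least 1/2, so it and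
  its root are controlled by its square, split into the powers 3/2 and 1/2.\<close>

lemma log_terms_bound:
  fixes n m :: nat
  assumes "1 \<le> n" "n \<le> m"
  shows "sqrt (ln (real n)) \<le> 4 * (ln (real n) powr (3/2) * sqrt (ln (real m)))"
    and "ln (real n) \<le> 4 * (ln (real n) powr (3/2) * sqrt (ln (real m)))"
proof -
  let ?l = "ln (real n)"
  have l0: "0 \<le> ?l" using assms by simp
  have "sqrt ?l \<le> 4 * (?l powr (3/2) * sqrt (ln (real m))) \<and> ?l \<le> 4 * (?l powr (3/2) * sqrt (ln (real m)))"
  proof (cases "n = 1")
    case True then show ?thesis by simp
  next
    case False
    then have "ln 2 \<le> ?l" using assms by simp
    then have l: "1 / 2 \<le> ?l" using ln2_ge_two_thirds by linarith
    have "?l\<^sup>2 = ?l powr (3/2) * ?l powr (1/2)"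
      using l by (simp add: powr_add[symmetric])
    also have "\<dots> \<le> ?l powr (3/2) * sqrt (ln (real m))"
      using assms l by (intro mult_left_mono) (auto simp: powr_half_sqrt)
    finally have sq: "?l\<^sup>2 \<le> ?l powr (3/2) * sqrt (ln (real m))" .
    have "2 * ?l \<ge> 1" using l by simp
    then have "1 * ?l \<le> 2 * ?l * ?l" using l by (intro mult_right_mono) auto
    then have a: "?l \<le> 2 * ?l\<^sup>2" by (simp add: power2_eq_square)
    have "sqrt ?l \<le> 2 * ?l"
    proof (rule real_le_lsqrt)
      have "(2 * ?l)\<^sup>2 = 4 * ?l\<^sup>2" by (simp add: power_mult_distrib)
      then show "?l \<le> (2 * ?l)\<^sup>2" using a zero_le_power2[of ?l] by linarith
    qed (use l in auto)
    then have "sqrt ?l \<le> 4 * ?l\<^sup>2" using a by linarith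
    moreover have "?l \<le> 4 * ?l\<^sup>2" using a zero_le_power2[of ?l] by linarith
    ultimately show ?thesis using sq by linarith
  qed
  then show "sqrt ?l \<le> 4 * (?l powr (3/2) * sqrt (ln (real m)))"
    "?l \<le> 4 * (?l powr (3/2) * sqrt (ln (real m)))" by auto
qed

text \<open>With t = Q n / m the left side is sqrt (t + 2 t^2), at most sqrt t + 2 t. The bound on
  \<open>Q\<close> separates \<open>p\<close> from the logarithm, which goes into the first
  term.\<close>

lemma moment_bound_le:
  fixes n m p :: nat
  assumes n: "1 \<le> n" "n \<le> m" and p: "1 \<le> p" and Q: "real Q \<le> 2 * real p + ln (real n)"
  shows "sqrt (real Q * real n * (real m + 2 * real Q * real n)) / real m
    \<le> 12 * (sqrt (real n / real m) * ln (real n) powr (3/2) * sqrt (ln (real m))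
            + sqrt (real n / real m) * sqrt (real p) + real n / real m * real p)"
proof -
  define r where "r = real n / real m"
  define t where "t = real Q * r"
  define W where "W = ln (real n) powr (3/2) * sqrt (ln (real m))"
  let ?l = "ln (real n)"
  have m: "0 < real m" using n by simp
  have r: "0 \<le> r" "r \<le> 1" using n by (auto simp: r_def)
  have l0: "0 \<le> ?l" using n by simp
  have t0: "0 \<le> t" using r by (simp add: t_def)
  \<comment> \<open>This moves the logarithmic part of the linear term under the square-root
    term.\<close>
  have rs: "r \<le> sqrt r" using r by (metis real_sqrt_ge_0_iff mult_left_le real_sqrt_le_1_iff real_sqrt_mult_self abs_of_nonneg)
  have "real Q * real n * (real m + 2 * real Q * real n) = (t + 2 * t\<^sup>2) * (real m)\<^sup>2"
    using m by (simp add: t_def r_def field_simps power2_eq_square)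
  then have "sqrt (real Q * real n * (real m + 2 * real Q * real n)) / real m = sqrt (t + 2 * t\<^sup>2)"
    using m by (simp add: real_sqrt_mult)
  also have "\<dots> \<le> sqrt t + sqrt (2 * t\<^sup>2)" using t0 by (intro sqrt_add_le_add_sqrt) auto
  also have "sqrt (2 * t\<^sup>2) \<le> 2 * t" using t0 by (intro real_le_lsqrt) (auto simp: power_mult_distrib)
  \<comment> \<open>Relaxing 2p to 4p makes its root 2 sqrt p.\<close>
  also have "sqrt t + 2 * t \<le> sqrt ((4 * real p + ?l) * r) + 2 * ((2 * real p + ?l) * r)"
    unfolding t_def using Q r p by (intro add_mono mult_left_mono real_sqrt_le_mono mult_right_mono) auto
  also have "sqrt ((4 * real p + ?l) * r) \<le> (2 * sqrt (real p) + sqrt ?l) * sqrt r"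
    unfolding real_sqrt_mult using r l0 sqrt_add_le_add_sqrt[of "4 * real p" ?l]
    by (intro mult_right_mono) (auto simp: real_sqrt_mult)
  finally have 1: "sqrt (real Q * real n * (real m + 2 * real Q * real n)) / real m
     \<le> (2 * sqrt (real p) + sqrt ?l) * sqrt r + 2 * ((2 * real p + ?l) * r)" by simp
  have 2: "sqrt ?l * sqrt r \<le> 4 * W * sqrt r"
    unfolding W_def using r by (intro mult_right_mono log_terms_bound n) auto
  have "?l * r \<le> ?l * sqrt r" using l0 rs by (rule mult_left_mono[rotated])
  also have "\<dots> \<le> 4 * W * sqrt r"
    unfolding W_def using r by (intro mult_right_mono log_terms_bound n) auto
  finally have 3: "?l * r \<le> 4 * W * sqrt r" .
  have 4: "0 \<le> sqrt (real p) * sqrt r" "0 \<le> real p * r" using r by auto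
  \<comment> \<open>The logarithmic terms add up to 4 + 2 * 4 = 12, the largest of the three
    coefficients.\<close>
  have "(2 * sqrt (real p) + sqrt ?l) * sqrt r + 2 * ((2 * real p + ?l) * r)
     \<le> 12 * (sqrt r * W + sqrt r * sqrt (real p) + r * real p)"
    using 2 3 4 by (simp add: algebra_simps)
  then show ?thesis using 1 by (simp add: W_def r_def mult.assoc)
qed

theorem theorem7:
  shows "\<exists>C>0. \<forall>\<sigma>2::real. \<sigma>2 > 0 \<longrightarrow> (\<exists>C\<sigma>>0. \<forall>(n::nat) (m::nat) (b::nat \<Rightarrow> complex) (p::nat).
     1 \<le> n \<longrightarrow> n \<le> m \<longrightarrow> real m \<ge> C * real n * (ln (real n)) ^ 4 \<longrightarrow> 1 \<le> p \<longrightarrow>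
     lp_norm (cgauss_vec \<sigma>2 m) p (Nsup m n b)
       \<le> ennreal (C\<sigma> * sup_norm m b *
           (sqrt (real n / real m) * ln (real n) powr (3/2) * sqrt (ln (real m))
            + sqrt (real n / real m) * sqrt (real p)
            + real n / real m * real p)))"
proof (rule exI[of _ 1], intro conjI allI impI)
  fix s2 :: real assume s2: "0 < s2"
  show "\<exists>C\<sigma>>0. \<forall>(n::nat) (m::nat) (b::nat \<Rightarrow> complex) (p::nat).
     1 \<le> n \<longrightarrow> n \<le> m \<longrightarrow> real m \<ge> 1 * real n * (ln (real n)) ^ 4 \<longrightarrow> 1 \<le> p \<longrightarrow>
     lp_norm (cgauss_vec s2 m) p (Nsup m n b)
       \<le> ennreal (C\<sigma> * sup_norm m b *
           (sqrt (real n / real m) * ln (real n) powr (3/2) * sqrt (ln (real m))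
            + sqrt (real n / real m) * sqrt (real p)
            + real n / real m * real p))"
  \<comment> \<open>120 from the moment bound times 12 from its simplification.\<close>
  proof (rule exI[of _ "1440 * s2"], intro conjI allI impI)
    fix n m p :: nat and b :: "nat \<Rightarrow> complex"
    assume n: "1 \<le> n" "n \<le> m" and p: "1 \<le> p"
    \<comment> \<open>\<open>Q\<close> dominates \<open>p\<close>, for the order of the moment, and
      ln n, so that n \<le> e^Q \<le> 3^Q; rounding up adds at most 1, which the second
      \<open>p\<close> in the bound on \<open>Q\<close> absorbs.\<close>
    define Q where "Q = p + nat \<lceil>ln (real n)\<rceil>"
    have l0: "0 \<le> ln (real n)" using n by simp
    have Q1: "ln (real n) \<le> real Q" unfolding Q_def using l0 by linarith
    have Q2: "real Q \<le> 2 * real p + ln (real n)" unfolding Q_def using l0 p by linarith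
    have "real n = exp (ln (real n))" using n by simp
    also have "\<dots> \<le> exp (real Q)" using Q1 by simp
    also have "\<dots> = exp 1 ^ Q" by (simp add: exp_of_nat_mult[symmetric])
    also have "\<dots> \<le> 3 ^ Q" using exp_le by (intro power_mono) auto
    finally have n3: "real n \<le> 3 ^ Q" .
    have s0: "0 \<le> sup_norm m b"
    proof -
      have "cmod (b 0) \<le> sup_norm m b" unfolding sup_norm_def using n by (intro Max_ge) auto
      then show ?thesis using norm_ge_zero order_trans by blast
    qed
    have "lp_norm (cgauss_vec s2 m) p (Nsup m n b)
      \<le> ennreal (120 * s2 * sup_norm m b / real m * sqrt (real Q * real n * (real m + 2 * real Q * real n)))"
      by (rule lp_norm_Nsup_le[OF s2 _ n(2) n3 p]) (use n in \<open>auto simp: Q_def\<close>)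
    also have "120 * s2 * sup_norm m b / real m * sqrt (real Q * real n * (real m + 2 * real Q * real n))
       = 120 * s2 * sup_norm m b * (sqrt (real Q * real n * (real m + 2 * real Q * real n)) / real m)"
      by simp
    also have "ennreal \<dots> \<le> ennreal (120 * s2 * sup_norm m b *
        (12 * (sqrt (real n / real m) * ln (real n) powr (3/2) * sqrt (ln (real m))
            + sqrt (real n / real m) * sqrt (real p) + real n / real m * real p)))"
      by (intro ennreal_leI mult_left_mono moment_bound_le[OF n p Q2]) (use s2 s0 in auto)
    finally show "lp_norm (cgauss_vec s2 m) p (Nsup m n b)
       \<le> ennreal (1440 * s2 * sup_norm m b *
           (sqrt (real n / real m) * ln (real n) powr (3/2) * sqrt (ln (real m))
            + sqrt (real n / real m) * sqrt (real p)
            + real n / real m * real p))"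
      by (simp add: mult_ac)
  qed (use s2 in simp)
qed simp

end
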